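(* Suppose LTE uses listen-before-talk with random back-off with $(a,b)=(0,1)$, i.e. all AP timers $t_i^W$ and all eNB timers $t_k^L$ are uniform on $[0,1]$, and the medium access indicators of AP $x_i$ and eNB $y_k$ are $$e_i^W=\prod_{x_j\in\Phi_W\setminus\{x_i\}}\Bigl(\mathbf 1_{\{t_j^W\ge t_i^W\}}+\mathbf 1_{\{t_j^W<t_i^W\}}\mathbf 1_{\{G^W_{j,i}/l(\|x_j-x_i\|)\le\Gamma_{cs}/P_W\}}\Bigr)\prod_{y_m\in\Phi_L}\Bigl(\mathbf 1_{\{t_m^L\ge t_i^W\}}+\mathbf 1_{\{t_m^L<t_i^W\}}\mathbf 1_{\{G^{LW}_{m,i}/l(\|y_m-x_i\|)\le\Gamma_{ed}/P_L\}}\Bigr),$$ $$e_k^L=\prod_{x_j\in\Phi_W}\Bigl(\mathbf 1_{\{t_j^W\ge t_k^L\}}+\mathbf 1_{\{t_j^W<t_k^L\}}\mathbf 1_{\{G^{WL}_{j,k}/l(\|x_j-y_k\|)\le\Gamma^L/P_W\}}\Bigr)\prod_{y_m\in\Phi_L\setminus\{y_k\}}\Bigl(\mathbf 1_{\{t_m^L\ge t_k^L\}}+\mathbf 1_{\{t_m^L<t_k^L\}}\mathbf 1_{\{G^{L}_{m,k}/l(\|y_m-y_k\|)\le\Gamma^L/P_L\}}\Bigr).$$ Then the medium access probabilities of a typical AP and a typical eNB (the Palm probabilities, with respect to $\Phi_W$ and $\Phi_L$ respectively, that the indicator of the typical point equals $1$) are $$p^W_{3,\mathrm{MAP}}(\lambda_W,\lambda_L)=\frac{1-\exp(-N^W-N^L)}{N^W+N^L},\qquad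 p^L_{3,\mathrm{MAP}}(\lambda_W,\lambda_L)=\frac{1-\exp(-N_3^W(\Gamma^L)-N_3^L(\Gamma^L))}{N_3^W(\Gamma^L)+N_3^L(\Gamma^L)}.$$
   Context: Wi-Fi access points (APs) form a homogeneous Poisson point process $\Phi_W=\{x_i\}$ on $\mathbb R^2$ with intensity $\lambda_W>0$; LTE base stations (eNBs) form an independent homogeneous Poisson point process $\Phi_L=\{y_k\}$ on $\mathbb R^2$ with intensity $\lambda_L>0$. Transmit powers are $P_W,P_L>0$. The path loss is $l(d)=(4\pi/\lambda_c)^2 d^{\alpha}$ with wavelength $\lambda_c>0$ and path loss exponent $\alpha>0$. $\Gamma_{cs},\Gamma_{ed}>0$ are Wi-Fi's carrier sensing and energy detection thresholds, $\Gamma^L>0$ is the LTE sensing threshold. $G^W_{j,i},G^{LW}_{m,i},G^{WL}_{j,k},G^L_{m,k}$ are the fadings from AP $x_j$ to AP $x_i$, eNB $y_m$ to AP $x_i$, AP $x_j$ to eNB $y_k$, eNB $y_m$ to eNB $y_k$; all fading variables are i.i.d. exponential with $\mathbb P(G>s)=e^{-\mu s}$, $\mu>0$. The point processes, the timers and the fading variables are all mutually independent. Define, for $\Gamma>0$, $$N_3^L(\Gamma)=\lambda_L\int_{\mathbb R^2}\exp\Bigl(-\mu\tfrac{\Gamma}{P_L}l(\|x\|)\Bigr)dx,\quad N_3^W(\Gamma)=\lambda_W\int_{\mathbb R^2}\exp\Bigl(-\mu\tfrac{\Gamma}{P_W}l(\|x\|)\Bigr)dx,$$ and $N^L=N_3^L(\Gamma_{ed})$,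 $N^W=N_3^W(\Gamma_{cs})$. *)

theory Defs
  imports "HOL-Probability.Probability"
begin

type_synonym plane = "real ^ 2"

text \<open>
  A point process in the plane is given by a sequence of random points
  \<open>x i\<close>, its atoms; a point carrying several indices is counted with
  multiplicity.  Marks of the points (timers, fading) are indexed by the same
  indices.
\<close>

definition point_count :: "(nat \<Rightarrow> 'w \<Rightarrow> plane) \<Rightarrow> plane set \<Rightarrow> 'w \<Rightarrow> nat" where
  "point_count x A \<omega> = card {i. x i \<omega> \<in> A}"

text \<open>
  The almost sure finiteness clause is needed because \<open>card\<close> is 0 on infinite
  sets.  The Poisson weights are written out because \<open>poisson_pmf\<close> is only
  specified for a positive rate, whereas null sets have rate 0.
\<close>

definition homogeneous_ppp :: "'w measure \<Rightarrow> real \<Rightarrow> (nat \<Rightarrow> 'w \<Rightarrow> plane) \<Rightarrow> bool" where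
  "homogeneous_ppp M lam x \<longleftrightarrow>
     (\<forall>i. x i \<in> borel_measurable M) \<and>
     (\<forall>A\<in>sets (borel :: plane measure). bounded A \<longrightarrow> (AE \<omega> in M. finite {i. x i \<omega> \<in> A})) \<and>
     (\<forall>A\<in>sets (borel :: plane measure). bounded A \<longrightarrow>
        (\<forall>n. measure M {\<omega> \<in> space M. point_count x A \<omega> = n} =
             (lam * measure lborel A) ^ n / fact n * exp (- (lam * measure lborel A)))) \<and>
     (\<forall>(A :: nat \<Rightarrow> plane set) n. (\<forall>k<n. A k \<in> sets borel \<and> bounded (A k)) \<and> disjoint_family_on A {..<n} \<longrightarrow>
        prob_space.indep_vars M (\<lambda>_. count_space UNIV) (\<lambda>k. point_count x (A k)) {..<n})"

text \<open>
  The Palm probability of a mark event \<open>E\<close> (\<open>E i \<omega>\<close>: the event holds, as seen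
  from the point \<open>x i\<close>), for a process of intensity \<open>lam\<close> and observation window
  \<open>B\<close>, in Campbell--Matthes form
  \[ \frac{1}{\lambda |B|} \, \mathbf{E} \sum_{i : x_i \in B} 1_{E_i} . \]
  For jointly stationary points and marks it does not depend on the choice of \<open>B\<close>.
\<close>

definition palm_prob ::
  "'w measure \<Rightarrow> real \<Rightarrow> (nat \<Rightarrow> 'w \<Rightarrow> plane) \<Rightarrow> (nat \<Rightarrow> 'w \<Rightarrow> bool) \<Rightarrow> plane set \<Rightarrow> ennreal" where
  "palm_prob M lam x E B =
     (\<integral>\<^sup>+\<omega>. (\<Sum>i. of_bool (x i \<omega> \<in> B \<and> E i \<omega>)) \<partial>M) / (ennreal lam * emeasure lborel B)"

definition path_loss :: "real \<Rightarrow> real \<Rightarrow> real \<Rightarrow> real" where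
  "path_loss lam_c \<alpha> d = (4 * pi / lam_c)\<^sup>2 * d powr \<alpha>"

definition N3 :: "(real \<Rightarrow> real) \<Rightarrow> real \<Rightarrow> real \<Rightarrow> real \<Rightarrow> real \<Rightarrow> real" where
  "N3 l \<mu> lam P \<Gamma> = lam * (\<integral>z. exp (- \<mu> * (\<Gamma> / P) * l (norm (z :: plane))) \<partial>lborel)"

text \<open>
  Factor contributed to the access indicator of a device with timer \<open>t\<close> by a
  contender with timer \<open>t'\<close> whose received fading-over-path-loss is \<open>q\<close>.
\<close>

definition lbt_factor :: "real \<Rightarrow> real \<Rightarrow> real \<Rightarrow> real \<Rightarrow> real" where
  "lbt_factor t t' q \<theta> = of_bool (t' \<ge> t) + of_bool (t' < t) * of_bool (q \<le> \<theta>)"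

text \<open>
  Infinite product as the limit of its partial products.  The limit exists for
  all factors in \<open>[0, 1]\<close>; \<open>prodinf\<close> is unsuitable, since it is unspecified when
  infinitely many factors vanish.
\<close>

definition infprod_except :: "nat set \<Rightarrow> (nat \<Rightarrow> real) \<Rightarrow> real" where
  "infprod_except J f = lim (\<lambda>n. \<Prod>j\<in>{..<n} - J. f j)"

text \<open>In all fading families \<open>G j i\<close> the first index is the transmitter.\<close>

definition ap_access ::
  "(real \<Rightarrow> real) \<Rightarrow> real \<Rightarrow> real \<Rightarrow> real \<Rightarrow> real \<Rightarrow>
   (nat \<Rightarrow> 'w \<Rightarrow> plane) \<Rightarrow> (nat \<Rightarrow> 'w \<Rightarrow> plane) \<Rightarrow> (nat \<Rightarrow> 'w \<Rightarrow> real) \<Rightarrow> (nat \<Rightarrow> 'w \<Rightarrow> real) \<Rightarrow>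
   (nat \<Rightarrow> nat \<Rightarrow> 'w \<Rightarrow> real) \<Rightarrow> (nat \<Rightarrow> nat \<Rightarrow> 'w \<Rightarrow> real) \<Rightarrow> nat \<Rightarrow> 'w \<Rightarrow> real" where
  "ap_access l P_W P_L \<Gamma>_cs \<Gamma>_ed x y tW tL GW GLW i \<omega> =
     infprod_except {i} (\<lambda>j. lbt_factor (tW i \<omega>) (tW j \<omega>)
        (GW j i \<omega> / l (norm (x j \<omega> - x i \<omega>))) (\<Gamma>_cs / P_W)) *
     infprod_except {} (\<lambda>m. lbt_factor (tW i \<omega>) (tL m \<omega>)
        (GLW m i \<omega> / l (norm (y m \<omega> - x i \<omega>))) (\<Gamma>_ed / P_L))"

definition enb_access ::
  "(real \<Rightarrow> real) \<Rightarrow> real \<Rightarrow> real \<Rightarrow> real \<Rightarrow>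
   (nat \<Rightarrow> 'w \<Rightarrow> plane) \<Rightarrow> (nat \<Rightarrow> 'w \<Rightarrow> plane) \<Rightarrow> (nat \<Rightarrow> 'w \<Rightarrow> real) \<Rightarrow> (nat \<Rightarrow> 'w \<Rightarrow> real) \<Rightarrow>
   (nat \<Rightarrow> nat \<Rightarrow> 'w \<Rightarrow> real) \<Rightarrow> (nat \<Rightarrow> nat \<Rightarrow> 'w \<Rightarrow> real) \<Rightarrow> nat \<Rightarrow> 'w \<Rightarrow> real" where
  "enb_access l P_W P_L \<Gamma>_L x y tW tL GWL GL k \<omega> =
     infprod_except {} (\<lambda>j. lbt_factor (tL k \<omega>) (tW j \<omega>)
        (GWL j k \<omega> / l (norm (x j \<omega> - y k \<omega>))) (\<Gamma>_L / P_W)) *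
     infprod_except {k} (\<lambda>m. lbt_factor (tL k \<omega>) (tL m \<omega>)
        (GL m k \<omega> / l (norm (y m \<omega> - y k \<omega>))) (\<Gamma>_L / P_L))"

text \<open>
  Index type for the sources of randomness.  They have different value types, so
  their mutual independence is stated for the sigma-algebras they generate; each
  point process is a single source.
\<close>

datatype source =
    AP_points | ENB_points
  | AP_timer nat | ENB_timer nat
  | Fading_W nat nat | Fading_LW nat nat | Fading_WL nat nat | Fading_L nat nat

definition generated_sigma :: "'w measure \<Rightarrow> ('w \<Rightarrow> 'b) \<Rightarrow> 'b measure \<Rightarrow> 'w set set" where
  "generated_sigma M X N = {X -` A \<inter> space M | A. A \<in> sets N}"

primrec source_sigma ::
  "'w measure \<Rightarrow> (nat \<Rightarrow> 'w \<Rightarrow> plane) \<Rightarrow> (nat \<Rightarrow> 'w \<Rightarrow> plane) \<Rightarrow>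
   (nat \<Rightarrow> 'w \<Rightarrow> real) \<Rightarrow> (nat \<Rightarrow> 'w \<Rightarrow> real) \<Rightarrow>
   (nat \<Rightarrow> nat \<Rightarrow> 'w \<Rightarrow> real) \<Rightarrow> (nat \<Rightarrow> nat \<Rightarrow> 'w \<Rightarrow> real) \<Rightarrow>
   (nat \<Rightarrow> nat \<Rightarrow> 'w \<Rightarrow> real) \<Rightarrow> (nat \<Rightarrow> nat \<Rightarrow> 'w \<Rightarrow> real) \<Rightarrow> source \<Rightarrow> 'w set set" where
  "source_sigma M x y tW tL GW GLW GWL GL AP_points =
     generated_sigma M (\<lambda>\<omega> i. x i \<omega>) (Pi\<^sub>M UNIV (\<lambda>_. borel))"
| "source_sigma M x y tW tL GW GLW GWL GL ENB_points =
     generated_sigma M (\<lambda>\<omega> k. y k \<omega>) (Pi\<^sub>M UNIV (\<lambda>_. borel))"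
| "source_sigma M x y tW tL GW GLW GWL GL (AP_timer i) = generated_sigma M (tW i) borel"
| "source_sigma M x y tW tL GW GLW GWL GL (ENB_timer k) = generated_sigma M (tL k) borel"
| "source_sigma M x y tW tL GW GLW GWL GL (Fading_W j i) = generated_sigma M (GW j i) borel"
| "source_sigma M x y tW tL GW GLW GWL GL (Fading_LW m i) = generated_sigma M (GLW m i) borel"
| "source_sigma M x y tW tL GW GLW GWL GL (Fading_WL j k) = generated_sigma M (GWL j k) borel"
| "source_sigma M x y tW tL GW GLW GWL GL (Fading_L m k) = generated_sigma M (GL m k) borel"

end

theory Submission
  imports Defs "HOL-Real_Asymp.Real_Asymp"
begin

text \<open>
  A contender at displacement \<open>z\<close> silences a device with timer \<open>t\<close> with probability
  \<open>t p(z)\<close>, where \<open>p(z)\<close> is the probability that its signal exceeds the threshold.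
  Given the points and the timer of the device, all other marks can be integrated out one
  at a time, each contender contributing a factor \<open>1 - t p(z)\<close>.  The Laplace functional
  of one process and the Mecke formula for the other then turn the products into
  \<open>exp (- t (N\<^sub>W + N\<^sub>L))\<close>, and integration over \<open>t \<in> [0, 1]\<close> gives the claim.

  The Mecke formula is obtained from the joint law of the counts alone.  If the interaction
  depends on the points only through finitely many cells, the sum over points splits into
  terms \<open>n\<^sub>k s\<^sub>k\<^sub>k ^ (n\<^sub>k - 1) \<Prod>\<^sub>j s\<^sub>k\<^sub>j ^ n\<^sub>j\<close> (product over \<open>j \<noteq> k\<close>) in the independent
  Poisson counts \<open>n\<^sub>j\<close>; the general case follows by refining the cells.
\<close>

subsection \<open>Infinite products of factors in the unit interval\<close>

text \<open>The hypotheses describe a Poisson process only through its counts in finitely many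
  disjoint bounded sets. Nothing is said about the law of a single atom \<open>x i\<close>, and the
  numbering may depend on the configuration, so only sums over all indices can be computed from the
  points. The marks, in contrast, are independent of the whole sequence of points; they are
  integrated out for one fixed index, and the summation over indices comes afterwards. The obstacle
  in between is that all factors of one device share its own timer. That timer is kept frozen at
  \<open>t\<close> until the Mecke formula has been applied, and since all devices have the same
  timer law, one outer integral over \<open>t\<close> serves all indices. The factor
  \<open>t\<close> in \<open>t p(z)\<close> is the probability that a uniform contender timer falls
  below \<open>t\<close>. The thresholds stay general, so that only the access of an AP has to be
  treated: the claim about an eNB is the same statement with the two networks exchanged.\<close>

lemma infprod_except_tendsto:
  assumes "\<And>j. 0 \<le> f j" "\<And>j. f j \<le> 1"
  shows "(\<lambda>n. \<Prod>j\<in>{..<n} - J. f j) \<longlonglongrightarrow> infprod_except J f"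
    and "decseq (\<lambda>n. \<Prod>j\<in>{..<n} - J. f j)"
proof -
  show dec: "decseq (\<lambda>n. \<Prod>j\<in>{..<n} - J. f j)"
  proof (rule decseq_SucI)
    fix n
    have "(\<Prod>j\<in>{..<Suc n} - J. f j) = (if n \<in> J then 1 else f n) * (\<Prod>j\<in>{..<n} - J. f j)"
      by (auto simp: lessThan_Suc insert_Diff_if)
    also have "\<dots> \<le> (\<Prod>j\<in>{..<n} - J. f j)"
      using assms by (auto intro!: mult_left_le_one_le prod_nonneg)
    finally show "(\<Prod>j\<in>{..<Suc n} - J. f j) \<le> (\<Prod>j\<in>{..<n} - J. f j)" .
  qed
  moreover have "Bseq (\<lambda>n. \<Prod>j\<in>{..<n} - J. f j)"
    using assms by (intro BseqI'[where K = 1]) (auto simp: abs_prod intro!: prod_le_1)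
  ultimately have "convergent (\<lambda>n. \<Prod>j\<in>{..<n} - J. f j)"
    by (intro Bseq_monoseq_convergent) (auto simp: monoseq_iff)
  then show "(\<lambda>n. \<Prod>j\<in>{..<n} - J. f j) \<longlonglongrightarrow> infprod_except J f"
    unfolding infprod_except_def by (simp add: convergent_LIMSEQ_iff)
qed

lemma infprod_except_le_partial:
  assumes "\<And>j. 0 \<le> f j" "\<And>j. f j \<le> 1"
  shows "infprod_except J f \<le> (\<Prod>j\<in>{..<n} - J. f j)"
  using infprod_except_tendsto[of f J] assms by (intro decseq_ge) auto

lemma infprod_except_bounds:
  assumes "\<And>j. 0 \<le> f j" "\<And>j. f j \<le> 1"
  shows "0 \<le> infprod_except J f" and "infprod_except J f \<le> 1"
proof -
  show "0 \<le> infprod_except J f"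
    using infprod_except_tendsto(1)[of f J] assms
    by (intro LIMSEQ_le_const) (auto intro!: prod_nonneg)
  show "infprod_except J f \<le> 1"
    using infprod_except_le_partial[of f J 0] assms by simp
qed

text \<open>The set {0, 1} is closed and contains every partial product. Thus an access product is a
  genuine indicator, and the probability that it equals 1 is its expectation.\<close>

lemma infprod_except_zero_one:
  assumes "\<And>j. f j \<in> {0, 1}"
  shows "infprod_except J f \<in> {0, 1}"
proof -
  have f: "0 \<le> f j" "f j \<le> 1" for j
    using assms[of j] by auto
  have "(\<Prod>j\<in>{..<n} - J. f j) \<in> {0, 1}" for n
  proof (cases "\<exists>j\<in>{..<n} - J. f j = 0")
    case False
    then have "f j = 1" if "j \<in> {..<n} - J" for j
      using assms[of j] that by auto
    then show ?thesis by simp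
  next
    case True
    then have "(\<Prod>j\<in>{..<n} - J. f j) = 0"
      by (intro prod_zero) auto
    then show ?thesis by simp
  qed
  then show ?thesis
    by (intro Lim_in_closed_set[OF _ _ _ infprod_except_tendsto(1)[of f J, OF f]]
          finite_imp_closed always_eventually allI) simp_all
qed

text \<open>The partial products are eventually constant. Almost surely this applies with
  \<open>F\<close> the indices of the points in a bounded window.\<close>

lemma infprod_except_finite_support:
  assumes "finite F" "\<And>j. j \<notin> F \<Longrightarrow> f j = 1"
  shows "infprod_except J f = (\<Prod>j\<in>F - J. f j)"
proof -
  obtain m where m: "F \<subseteq> {..<m}"
    using finite_nat_iff_bounded assms(1) by auto
  have "(\<Prod>j\<in>{..<n} - J. f j) = (\<Prod>j\<in>F - J. f j)" if "n \<ge> m" for n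
    using m that assms by (intro prod.mono_neutral_right) auto
  then have "(\<lambda>n. \<Prod>j\<in>{..<n} - J. f j) \<longlonglongrightarrow> (\<Prod>j\<in>F - J. f j)"
    by (intro tendsto_eventually) (auto simp: eventually_sequentially)
  then show ?thesis
    unfolding infprod_except_def by (rule limI)
qed

text \<open>The limit product is a lower bound factor by factor; for the upper bound the product is
  cut at some \<open>k\<close> that is good for \<open>g\<close>, and the finitely many remaining
  factors converge. Monotonicity is essential: with \<open>J\<close> empty, factors that are 0 at
  \<open>j = n\<close> and 1 elsewhere tend to 1 pointwise, while each of their products is
  0.\<close>

lemma infprod_except_decseq_tendsto:
  assumes f: "\<And>n j. 0 \<le> f n j" "\<And>n j. f n j \<le> 1"
    and dec: "\<And>n j. f (Suc n) j \<le> f n j"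
    and lim: "\<And>j. (\<lambda>n. f n j) \<longlonglongrightarrow> g j"
  shows "(\<lambda>n. infprod_except J (f n)) \<longlonglongrightarrow> infprod_except J g"
proof -
  have decf: "decseq (\<lambda>n. f n j)" for j
    by (rule decseq_SucI) (rule dec)
  have g0: "0 \<le> g j" and g1: "g j \<le> 1" for j
    by (rule LIMSEQ_le_const[OF lim] LIMSEQ_le_const2[OF lim]; simp add: f)+
  have gf: "g j \<le> f n j" for n j
    using decseq_ge[OF decf lim] .
  have lower: "infprod_except J g \<le> infprod_except J (f n)" for n
    by (rule LIMSEQ_le[OF infprod_except_tendsto(1) infprod_except_tendsto(1)])
       (use f g0 g1 gf in \<open>auto intro!: prod_mono\<close>)
  show ?thesis
  proof (rule LIMSEQ_I)
    fix e :: real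
    assume e: "0 < e"
    have "\<forall>\<^sub>F k in sequentially. (\<Prod>j\<in>{..<k} - J. g j) < infprod_except J g + e"
      using order_tendstoD(2)[OF infprod_except_tendsto(1)[of g J]] g0 g1 e by simp
    then obtain k where k: "(\<Prod>j\<in>{..<k} - J. g j) < infprod_except J g + e"
      by (auto simp: eventually_sequentially)
    have "(\<lambda>n. \<Prod>j\<in>{..<k} - J. f n j) \<longlonglongrightarrow> (\<Prod>j\<in>{..<k} - J. g j)"
      by (intro tendsto_prod lim)
    then have "\<forall>\<^sub>F n in sequentially. (\<Prod>j\<in>{..<k} - J. f n j) < infprod_except J g + e"
      using k by (rule order_tendstoD(2))
    then obtain n0 where n0: "\<And>n. n \<ge> n0 \<Longrightarrow> (\<Prod>j\<in>{..<k} - J. f n j) < infprod_except J g + e"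
      by (auto simp: eventually_sequentially)
    have "norm (infprod_except J (f n) - infprod_except J g) < e" if "n \<ge> n0" for n
      using n0[OF that] lower[of n] infprod_except_le_partial[of "f n" J k] f by simp
    then show "\<exists>no. \<forall>n\<ge>no. norm (infprod_except J (f n) - infprod_except J g) < e"
      by blast
  qed
qed

lemma measurable_infprod_except[measurable (raw)]:
  assumes [measurable]: "\<And>j. f j \<in> borel_measurable M"
  shows "(\<lambda>\<omega>. infprod_except J (\<lambda>j. f j \<omega>)) \<in> borel_measurable M"
  unfolding infprod_except_def by measurable

subsection \<open>Independence\<close>

text \<open>
  The library's \<open>indep_var\<close> forces both variables to have the same type.
\<close>

definition (in prob_space) indep_pair ::
  "'b measure \<Rightarrow> ('a \<Rightarrow> 'b) \<Rightarrow> 'c measure \<Rightarrow> ('a \<Rightarrow> 'c) \<Rightarrow> bool" where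
  "indep_pair S A T V \<longleftrightarrow> A \<in> measurable M S \<and> V \<in> measurable M T \<and>
     (\<forall>a\<in>sets S. \<forall>b\<in>sets T. prob ((A -` a \<inter> space M) \<inter> (V -` b \<inter> space M)) =
        prob (A -` a \<inter> space M) * prob (V -` b \<inter> space M))"

text \<open>The joint law agrees with the product of the two laws on rectangles, hence everywhere,
  and Tonelli's theorem applies. The second variable is evaluated at a separate outcome
  \<open>\<omega>'\<close>, so that inside the inner integral everything coming from
  \<open>A\<close> is a constant.\<close>

lemma (in prob_space) nn_integral_indep_pair:
  assumes ind: "indep_pair S A T V" and [measurable]: "f \<in> borel_measurable (S \<Otimes>\<^sub>M T)"
  shows "(\<integral>\<^sup>+\<omega>. f (A \<omega>, V \<omega>) \<partial>M) = (\<integral>\<^sup>+\<omega>. \<integral>\<^sup>+\<omega>'. f (A \<omega>, V \<omega>') \<partial>M \<partial>M)"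
proof -
  have [measurable]: "A \<in> measurable M S" "V \<in> measurable M T"
    using ind by (auto simp: indep_pair_def)
  interpret A: prob_space "distr M S A"
    by (rule prob_space_distr) measurable
  interpret V: prob_space "distr M T V"
    by (rule prob_space_distr) measurable
  have joint: "distr M S A \<Otimes>\<^sub>M distr M T V = distr M (S \<Otimes>\<^sub>M T) (\<lambda>\<omega>. (A \<omega>, V \<omega>))"
  proof (rule pair_measure_eqI)
    fix a b assume "a \<in> sets (distr M S A)" "b \<in> sets (distr M T V)"
    then have [measurable]: "a \<in> sets S" "b \<in> sets T"
      by auto
    have "(\<lambda>\<omega>. (A \<omega>, V \<omega>)) -` (a \<times> b) \<inter> space M = (A -` a \<inter> space M) \<inter> (V -` b \<inter> space M)"
      by auto
    then show "emeasure (distr M S A) a * emeasure (distr M T V) b =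
       emeasure (distr M (S \<Otimes>\<^sub>M T) (\<lambda>\<omega>. (A \<omega>, V \<omega>))) (a \<times> b)"
      using ind \<open>a \<in> sets S\<close> \<open>b \<in> sets T\<close>
      by (simp add: emeasure_distr emeasure_eq_measure indep_pair_def ennreal_mult[symmetric])
  qed (simp_all add: A.sigma_finite_measure_axioms V.sigma_finite_measure_axioms cong: sets_pair_measure_cong)
  have "(\<integral>\<^sup>+\<omega>. f (A \<omega>, V \<omega>) \<partial>M) = (\<integral>\<^sup>+p. f p \<partial>distr M (S \<Otimes>\<^sub>M T) (\<lambda>\<omega>. (A \<omega>, V \<omega>)))"
    by (subst nn_integral_distr) auto
  also have "\<dots> = (\<integral>\<^sup>+p. f p \<partial>(distr M S A \<Otimes>\<^sub>M distr M T V))"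
    by (simp add: joint)
  also have "\<dots> = (\<integral>\<^sup>+a. \<integral>\<^sup>+v. f (a, v) \<partial>distr M T V \<partial>distr M S A)"
    by (subst V.nn_integral_fst[symmetric]) (auto simp: case_prod_unfold)
  also have "\<dots> = (\<integral>\<^sup>+\<omega>. \<integral>\<^sup>+v. f (A \<omega>, v) \<partial>distr M T V \<partial>M)"
    by (subst nn_integral_distr) auto
  also have "\<dots> = (\<integral>\<^sup>+\<omega>. \<integral>\<^sup>+\<omega>'. f (A \<omega>, V \<omega>') \<partial>M \<partial>M)"
    by (intro nn_integral_cong, subst nn_integral_distr) (auto dest: measurable_space)
  finally show ?thesis .
qed

text \<open>Independence of intersection-stable generators passes to the sigma-algebras generated by
  disjoint groups of them. The two measurability hypotheses express that \<open>A\<close> depends on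
  the sources in \<open>I\<close> only and \<open>V\<close> on those in \<open>K\<close>
  only.\<close>

lemma (in prob_space) indep_pair_disjoint_sources:
  assumes E: "indep_sets E UNIV" "\<And>s. Int_stable (E s)"
    and A: "A \<in> measurable (sigma (space M) (\<Union>s\<in>I. E s)) S"
    and V: "V \<in> measurable (sigma (space M) (\<Union>s\<in>K. E s)) T"
    and IK: "I \<inter> K = {}"
  shows "indep_pair S A T V"
proof -
  have ev: "E s \<subseteq> events" for s
    using E(1) by (auto simp: indep_sets_def)
  have sp: "(\<Union>s\<in>L. E s) \<subseteq> Pow (space M)" for L
    using ev sets.space_closed[of M] by (intro UN_least order_trans[OF ev])
  let ?I = "case_bool I K"
  have "indep_sets (\<lambda>j. sigma_sets (space M) (\<Union>s\<in>?I j. E s)) UNIV"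
  proof (rule indep_sets_collect_sigma)
    show "indep_sets E (\<Union>j. ?I j)"
      by (rule indep_sets_mono_index[OF _ E(1)]) simp
    show "disjoint_family_on ?I UNIV"
      using IK by (auto simp: disjoint_family_on_def split: bool.splits)
  qed (rule E(2))
  moreover have "(\<lambda>j. sigma_sets (space M) (\<Union>s\<in>?I j. E s)) =
     case_bool (sigma_sets (space M) (\<Union>s\<in>I. E s)) (sigma_sets (space M) (\<Union>s\<in>K. E s))"
    by (auto split: bool.splits)
  ultimately have ind: "indep_set (sigma_sets (space M) (\<Union>s\<in>I. E s)) (sigma_sets (space M) (\<Union>s\<in>K. E s))"
    by (simp add: indep_set_def)
  have sets: "sets (sigma (space M) (\<Union>s\<in>L. E s)) = sigma_sets (space M) (\<Union>s\<in>L. E s)"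
    and space: "space (sigma (space M) (\<Union>s\<in>L. E s)) = space M" for L
    using sp[of L] by (simp_all add: sets_measure_of space_measure_of)
  have sub: "sets (sigma (space M) (\<Union>s\<in>L. E s)) \<subseteq> events" for L
    unfolding sets using ev by (intro sets.sigma_sets_subset) blast
  have "A \<in> measurable M S" "V \<in> measurable M T"
    using A V sub[of I] sub[of K] by (auto simp: measurable_def space)
  moreover have "A -` a \<inter> space M \<in> sigma_sets (space M) (\<Union>s\<in>I. E s)" if "a \<in> sets S" for a
    using measurable_sets[OF A that] by (simp add: sets space)
  moreover have "V -` b \<inter> space M \<in> sigma_sets (space M) (\<Union>s\<in>K. E s)" if "b \<in> sets T" for b
    using measurable_sets[OF V that] by (simp add: sets space)
  ultimately show ?thesis
    unfolding indep_pair_def using indep_setD[OF ind] by blast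
qed

lemma nn_integral_one_minus_indicator:
  assumes "prob_space N" "A \<in> sets N" "0 \<le> a" "a \<le> 1"
  shows "(\<integral>\<^sup>+v. ennreal (1 - a * indicator A v) \<partial>N) = ennreal (1 - a * measure N A)"
proof -
  interpret prob_space N by fact
  have "(\<integral>\<^sup>+v. ennreal (1 - a * indicator A v) \<partial>N) = ennreal (\<integral>v. 1 - a * indicator A v \<partial>N)"
    using assms by (intro nn_integral_eq_integral Bochner_Integration.integrable_diff
        integrable_mult_right integrable_real_indicator) (auto simp: emeasure_eq_measure split: split_indicator)
  also have "(\<integral>v. 1 - a * indicator A v \<partial>N) = 1 - a * measure N A"
    using assms by (subst Bochner_Integration.integral_diff) (auto simp: prob_space emeasure_eq_measure)
  finally show ?thesis .
qed

text \<open>The integrand is affine in the indicator of \<open>Q\<close>, so averaging over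
  \<open>V\<close> alone replaces that indicator by its probability with \<open>b\<close> frozen.
  Here \<open>b\<close> is the part of the remaining randomness on which the event depends, and
  \<open>a\<close> and \<Phi> are spectators. A contender is removed by two applications, one with
  \<open>V\<close> its fading and one with \<open>V\<close> its timer.\<close>

lemma (in prob_space) nn_integral_thin:
  fixes \<Phi> a :: "'a \<Rightarrow> real" and V :: "'a \<Rightarrow> 'v"
  assumes ind: "indep_pair (borel \<Otimes>\<^sub>M borel \<Otimes>\<^sub>M N) (\<lambda>\<omega>. (\<Phi> \<omega>, a \<omega>, b \<omega>)) L V"
    and Q[measurable]: "Measurable.pred (N \<Otimes>\<^sub>M L) (\<lambda>p. Q (fst p) (snd p))"
    and \<Phi>: "\<And>\<omega>. 0 \<le> \<Phi> \<omega>" and a: "\<And>\<omega>. 0 \<le> a \<omega>" "\<And>\<omega>. a \<omega> \<le> 1"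
  shows "(\<integral>\<^sup>+\<omega>. ennreal (\<Phi> \<omega> * (1 - a \<omega> * of_bool (Q (b \<omega>) (V \<omega>)))) \<partial>M) =
     (\<integral>\<^sup>+\<omega>. ennreal (\<Phi> \<omega> * (1 - a \<omega> * prob {\<omega>'\<in>space M. Q (b \<omega>) (V \<omega>')})) \<partial>M)"
proof -
  have [measurable]: "V \<in> measurable M L" 
    using ind by (simp add: indep_pair_def)
  have A: "(\<lambda>\<omega>. (\<Phi> \<omega>, a \<omega>, b \<omega>)) \<in> measurable M (borel \<Otimes>\<^sub>M borel \<Otimes>\<^sub>M N)"
    using ind by (simp add: indep_pair_def)
  have b[measurable]: "b \<in> measurable M N" 
    using measurable_compose[OF measurable_compose[OF A measurable_snd] measurable_snd] by simp
  let ?f = "\<lambda>p. ennreal (fst (fst p) * (1 - fst (snd (fst p)) * of_bool (Q (snd (snd (fst p))) (snd p))))"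
  have "(\<integral>\<^sup>+\<omega>. ennreal (\<Phi> \<omega> * (1 - a \<omega> * of_bool (Q (b \<omega>) (V \<omega>)))) \<partial>M) =
     (\<integral>\<^sup>+\<omega>. ?f ((\<Phi> \<omega>, a \<omega>, b \<omega>), V \<omega>) \<partial>M)"
    by simp
  also have "\<dots> = (\<integral>\<^sup>+\<omega>. \<integral>\<^sup>+\<omega>'. ?f ((\<Phi> \<omega>, a \<omega>, b \<omega>), V \<omega>') \<partial>M \<partial>M)"
  proof (rule nn_integral_indep_pair[OF ind])
    have "(\<lambda>p. (snd (snd (fst p)), snd p)) \<in> measurable ((borel \<Otimes>\<^sub>M borel \<Otimes>\<^sub>M N) \<Otimes>\<^sub>M L) (N \<Otimes>\<^sub>M L)"
      by measurable
    from measurable_compose[OF this Q]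
    have [measurable]: "Measurable.pred ((borel \<Otimes>\<^sub>M borel \<Otimes>\<^sub>M N) \<Otimes>\<^sub>M L) (\<lambda>p. Q (snd (snd (fst p))) (snd p))"
      by simp
    show "?f \<in> borel_measurable ((borel \<Otimes>\<^sub>M borel \<Otimes>\<^sub>M N) \<Otimes>\<^sub>M L)"
      by measurable
  qed
  also have "\<dots> = (\<integral>\<^sup>+\<omega>. ennreal (\<Phi> \<omega> * (1 - a \<omega> * prob {\<omega>'\<in>space M. Q (b \<omega>) (V \<omega>')})) \<partial>M)"
  proof (rule nn_integral_cong)
    fix \<omega> assume \<omega>: "\<omega> \<in> space M"
    have bN: "b \<omega> \<in> space N"
      using measurable_space[OF b \<omega>] .
    have "(\<lambda>v. (b \<omega>, v)) \<in> measurable L (N \<Otimes>\<^sub>M L)"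
      using bN by measurable
    from measurable_compose[OF this Q] 
    have [measurable]: "Measurable.pred L (\<lambda>v. Q (b \<omega>) v)"
      by simp
    let ?A = "{\<omega>'\<in>space M. Q (b \<omega>) (V \<omega>')}"
    have "(\<integral>\<^sup>+\<omega>'. ?f ((\<Phi> \<omega>, a \<omega>, b \<omega>), V \<omega>') \<partial>M) =
       (\<integral>\<^sup>+\<omega>'. ennreal (\<Phi> \<omega>) * ennreal (1 - a \<omega> * indicator ?A \<omega>') \<partial>M)"
      using \<Phi>[of \<omega>] by (intro nn_integral_cong) (auto simp: ennreal_mult' indicator_def)
    also have "\<dots> = ennreal (\<Phi> \<omega>) * (\<integral>\<^sup>+\<omega>'. ennreal (1 - a \<omega> * indicator ?A \<omega>') \<partial>M)"
      by (intro nn_integral_cmult) measurable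
    also have "\<dots> = ennreal (\<Phi> \<omega> * (1 - a \<omega> * prob ?A))"
      using \<Phi>[of \<omega>] a[of \<omega>]
      by (subst nn_integral_one_minus_indicator) (auto simp: ennreal_mult' prob_space_axioms)
    finally show "(\<integral>\<^sup>+\<omega>'. ?f ((\<Phi> \<omega>, a \<omega>, b \<omega>), V \<omega>') \<partial>M) = ennreal (\<Phi> \<omega> * (1 - a \<omega> * prob ?A))" .
  qed
  finally show ?thesis .
qed

subsection \<open>Laplace functional and Mecke formula of a Poisson process\<close>

locale poisson_points = prob_space M for M :: "'w measure" +
  fixes lam :: real and x :: "nat \<Rightarrow> 'w \<Rightarrow> plane"
  assumes lam_pos: "0 < lam" and ppp: "homogeneous_ppp M lam x"
begin

lemma points_measurable[measurable]: "x i \<in> borel_measurable M"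
  using ppp by (simp add: homogeneous_ppp_def)

lemma AE_finite_points:
  "A \<in> sets borel \<Longrightarrow> bounded A \<Longrightarrow> AE \<omega> in M. finite {i. x i \<omega> \<in> A}"
  using ppp by (simp add: homogeneous_ppp_def)

lemma indep_counts:
  fixes A :: "nat \<Rightarrow> plane set"
  assumes "\<And>k. k < n \<Longrightarrow> A k \<in> sets borel" "\<And>k. k < n \<Longrightarrow> bounded (A k)" "disjoint_family_on A {..<n}"
  shows "indep_vars (\<lambda>_. count_space UNIV) (\<lambda>k. point_count x (A k)) {..<n}"
  using ppp assms by (simp add: homogeneous_ppp_def)

text \<open>Read off from the independence clause for a family of length one, as
  \<open>indep_vars\<close> includes measurability.\<close>

lemma point_count_measurable[measurable]:
  assumes "A \<in> sets borel" "bounded A"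
  shows "point_count x A \<in> measurable M (count_space UNIV)"
  using indep_counts[of 1 "\<lambda>_. A"] assms
  by (simp add: indep_vars_def disjoint_family_on_def)

lemma nn_integral_point_count:
  assumes A: "A \<in> sets borel" "bounded A"
  shows "(\<integral>\<^sup>+\<omega>. \<phi> (point_count x A \<omega>) \<partial>M) =
    (\<Sum>n. \<phi> n * ennreal ((lam * measure lborel A) ^ n / fact n * exp (- (lam * measure lborel A))))"
proof -
  note [measurable] = point_count_measurable[OF A]
  have "(\<integral>\<^sup>+\<omega>. \<phi> (point_count x A \<omega>) \<partial>M) =
      (\<integral>\<^sup>+\<omega>. (\<Sum>n. \<phi> n * indicator {\<omega>\<in>space M. point_count x A \<omega> = n} \<omega>) \<partial>M)"
  proof (rule nn_integral_cong)
    fix \<omega> assume "\<omega> \<in> space M"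
    then have "(\<Sum>n. \<phi> n * indicator {\<omega>\<in>space M. point_count x A \<omega> = n} \<omega>) =
        (\<Sum>n\<in>{point_count x A \<omega>}. \<phi> n * indicator {\<omega>\<in>space M. point_count x A \<omega> = n} \<omega>)"
      by (intro suminf_finite) (auto simp: indicator_def)
    then show "\<phi> (point_count x A \<omega>) = (\<Sum>n. \<phi> n * indicator {\<omega>\<in>space M. point_count x A \<omega> = n} \<omega>)"
      using \<open>\<omega> \<in> space M\<close> by simp
  qed
  also have "\<dots> = (\<Sum>n. \<phi> n * emeasure M {\<omega>\<in>space M. point_count x A \<omega> = n})"
    by (subst nn_integral_suminf) (simp_all add: nn_integral_cmult_indicator)
  also have "\<dots> = (\<Sum>n. \<phi> n * ennreal ((lam * measure lborel A) ^ n / fact n * exp (- (lam * measure lborel A))))"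
    using ppp A by (simp add: emeasure_eq_measure homogeneous_ppp_def)
  finally show ?thesis .
qed

text \<open>The generating function of the Poisson law, summed by the exponential series. With
  \<open>0 ^ 0 = 1\<close> the case \<open>s = 0\<close> is the void probability.\<close>

lemma nn_integral_power_point_count:
  assumes A: "A \<in> sets borel" "bounded A" and s: "0 \<le> s"
  shows "(\<integral>\<^sup>+\<omega>. ennreal (s ^ point_count x A \<omega>) \<partial>M) =
    ennreal (exp (- (lam * measure lborel A * (1 - s))))"
proof -
  define m where "m = lam * measure lborel A"
  have m: "0 \<le> m"
    using lam_pos by (simp add: m_def)
  have "(\<lambda>n. exp (- m) * ((s * m) ^ n /\<^sub>R fact n)) sums (exp (- m) * exp (s * m))"
    by (intro sums_mult exp_converges)
  moreover have "(\<lambda>n. exp (- m) * ((s * m) ^ n /\<^sub>R fact n)) = (\<lambda>n. s ^ n * (m ^ n / fact n * exp (- m)))"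
    by (auto simp: field_simps power_mult_distrib)
  moreover have "exp (- m) * exp (s * m) = exp (- (m * (1 - s)))"
    by (simp add: exp_add[symmetric] algebra_simps)
  ultimately have "(\<lambda>n. s ^ n * (m ^ n / fact n * exp (- m))) sums exp (- (m * (1 - s)))"
    by simp
  then show ?thesis
    using s m unfolding nn_integral_point_count[OF A, of "\<lambda>n. ennreal (s ^ n)"] m_def[symmetric]
    by (subst ennreal_mult[symmetric]) (auto intro!: suminf_ennreal_eq)
qed

text \<open>The derivative in \<open>s\<close> of the generating function. It arises when one of the
  points of a cell is singled out as the device and only the others act as contenders; at
  \<open>s = 1\<close> it is the mean count.\<close>

lemma nn_integral_deriv_power_point_count:
  assumes A: "A \<in> sets borel" "bounded A" and s: "0 \<le> s"
  shows "(\<integral>\<^sup>+\<omega>. ennreal (real (point_count x A \<omega>) * s ^ (point_count x A \<omega> - 1)) \<partial>M) =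
    ennreal (lam * measure lborel A * exp (- (lam * measure lborel A * (1 - s))))"
proof -
  define m where "m = lam * measure lborel A"
  have m: "0 \<le> m"
    using lam_pos by (simp add: m_def)
  define f where "f n = real n * s ^ (n - 1) * (m ^ n / fact n * exp (- m))" for n
  have "(\<lambda>n. m * exp (- m) * ((s * m) ^ n /\<^sub>R fact n)) sums (m * exp (- m) * exp (s * m))"
    by (intro sums_mult exp_converges)
  moreover have "(\<lambda>n. m * exp (- m) * ((s * m) ^ n /\<^sub>R fact n)) = (\<lambda>n. f (Suc n))"
    by (auto simp: f_def field_simps power_mult_distrib simp del: of_nat_Suc)
  moreover have "m * exp (- m) * exp (s * m) = m * exp (- (m * (1 - s)))"
    by (simp add: exp_add[symmetric] algebra_simps)
  ultimately have "(\<lambda>n. f (Suc n)) sums (m * exp (- (m * (1 - s))))"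
    by simp
  \<comment> \<open>The term at 0 vanishes through its factor \<open>real n\<close>, so the
    truncated exponent \<open>0 - 1\<close> is harmless. In the other terms
    \<open>n / fact n\<close> cancels to \<open>1 / fact (n - 1)\<close>, hence the shift.\<close>
  from sums_Suc[OF this] have "f sums (m * exp (- (m * (1 - s))))"
    by (simp add: f_def[of 0])
  then show ?thesis
    using s m unfolding nn_integral_point_count[OF A, of "\<lambda>n. ennreal (real n * s ^ (n - 1))"] m_def[symmetric]
    by (subst ennreal_mult[symmetric]) (auto intro!: suminf_ennreal_eq simp: f_def[abs_def])
qed

text \<open>The independence clause speaks of families indexed by an initial segment of the
  naturals, while cells are indexed by labels of arbitrary type; an enumeration of \<open>C\<close>
  translates between the two.\<close>

lemma nn_integral_prod_point_count:
  fixes A :: "'k \<Rightarrow> plane set" and \<phi> :: "'k \<Rightarrow> nat \<Rightarrow> ennreal"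
  assumes C: "finite C" and A: "\<And>k. k \<in> C \<Longrightarrow> A k \<in> sets borel" "\<And>k. k \<in> C \<Longrightarrow> bounded (A k)"
    and dis: "disjoint_family_on A C"
  shows "(\<integral>\<^sup>+\<omega>. (\<Prod>k\<in>C. \<phi> k (point_count x (A k) \<omega>)) \<partial>M) =
    (\<Prod>k\<in>C. \<integral>\<^sup>+\<omega>. \<phi> k (point_count x (A k) \<omega>) \<partial>M)"
proof -
  obtain e where e: "bij_betw e {..<card C} C"
    using ex_bij_betw_nat_finite[OF C] by (auto simp: atLeast0LessThan)
  have eC: "e k \<in> C" if "k < card C" for k
    using e that by (auto simp: bij_betw_def)
  have "disjoint_family_on (\<lambda>k. A (e k)) {..<card C}"
    using dis e eC unfolding disjoint_family_on_def bij_betw_def inj_on_def by (metis lessThan_iff)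
  then have "indep_vars (\<lambda>_. count_space UNIV) (\<lambda>k. point_count x (A (e k))) {..<card C}"
    using A eC by (intro indep_counts) auto
  then have "indep_vars (\<lambda>_. borel) (\<lambda>k \<omega>. \<phi> (e k) (point_count x (A (e k)) \<omega>)) {..<card C}"
    by (rule indep_vars_compose2) auto
  from indep_vars_nn_integral[OF _ this]
  have "(\<integral>\<^sup>+\<omega>. (\<Prod>k<card C. \<phi> (e k) (point_count x (A (e k)) \<omega>)) \<partial>M) =
    (\<Prod>k<card C. \<integral>\<^sup>+\<omega>. \<phi> (e k) (point_count x (A (e k)) \<omega>) \<partial>M)"
    by simp
  then show ?thesis
    unfolding prod.reindex_bij_betw[OF e, of "\<lambda>k. \<integral>\<^sup>+\<omega>. \<phi> k (point_count x (A k) \<omega>) \<partial>M"]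
    using prod.reindex_bij_betw[OF e, of "\<lambda>k. \<phi> k (point_count x (A k) \<omega>)" for \<omega>] by simp
qed

end

section \<open>Laplace functional of a Poisson process\<close>

lemma partition_integral:
  fixes c :: "plane \<Rightarrow> 'k" and K :: "'k \<Rightarrow> real"
  assumes c: "simple_function borel c" and W: "W \<in> sets borel" "bounded W"
  shows "(\<integral>v. of_bool (v \<in> W) * K (c v) \<partial>lborel) =
    (\<Sum>k\<in>range c. K k * measure lborel (W \<inter> c -` {k}))"
proof -
  have C: "finite (range c)"
    using simple_functionD(1)[OF c] by simp
  have A: "W \<inter> c -` {k} \<in> sets borel" for k
    using simple_functionD(2)[OF c, of "{k}"] W(1) by auto
  have fin: "emeasure lborel (W \<inter> c -` {k}) < \<infinity>" for k
    using bounded_subset[OF W(2), of "W \<inter> c -` {k}"] by (intro emeasure_bounded_finite) auto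
  have "of_bool (v \<in> W) * K (c v) = (\<Sum>k\<in>range c. K k * indicator (W \<inter> c -` {k}) v)" for v
  proof -
    have "(\<Sum>k\<in>range c. K k * indicator (W \<inter> c -` {k}) v) =
        (\<Sum>k\<in>range c. if c v = k then K (c v) * of_bool (v \<in> W) else 0)"
      by (intro sum.cong) (auto simp: indicator_def)
    then show ?thesis
      using C by (simp add: mult.commute)
  qed
  then show ?thesis
    using A fin by (simp add: Bochner_Integration.integral_sum)
qed

context poisson_points
begin

text \<open>Almost surely \<open>W\<close> contains finitely many points, and grouping them by label
  turns the product into one power per cell, with base \<open>1 - K k\<close> and the count as
  exponent. The counts are independent, and each contributes its generating function.\<close>

lemma laplace_step:
  fixes c :: "plane \<Rightarrow> 'k" and K :: "'k \<Rightarrow> real"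
  assumes c: "simple_function borel c" and W: "W \<in> sets borel" "bounded W"
    and K: "\<And>k. 0 \<le> K k" "\<And>k. K k \<le> 1"
  shows "(\<integral>\<^sup>+\<omega>. ennreal (infprod_except {} (\<lambda>j. 1 - of_bool (x j \<omega> \<in> W) * K (c (x j \<omega>)))) \<partial>M) =
    ennreal (exp (- lam * (\<integral>v. of_bool (v \<in> W) * K (c v) \<partial>lborel)))"
proof -
  define C where "C = range c"
  define A where "A k = W \<inter> c -` {k}" for k
  have C: "finite C"
    using simple_functionD(1)[OF c] by (simp add: C_def)
  have A: "A k \<in> sets borel" "bounded (A k)" for k
    using simple_functionD(2)[OF c, of "{k}"] W by (auto simp: A_def intro: bounded_subset)
  have "(\<integral>\<^sup>+\<omega>. ennreal (infprod_except {} (\<lambda>j. 1 - of_bool (x j \<omega> \<in> W) * K (c (x j \<omega>)))) \<partial>M) =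
      (\<integral>\<^sup>+\<omega>. (\<Prod>k\<in>C. ennreal ((1 - K k) ^ point_count x (A k) \<omega>)) \<partial>M)"
  proof (rule nn_integral_cong_AE)
    show "AE \<omega> in M. ennreal (infprod_except {} (\<lambda>j. 1 - of_bool (x j \<omega> \<in> W) * K (c (x j \<omega>)))) =
        (\<Prod>k\<in>C. ennreal ((1 - K k) ^ point_count x (A k) \<omega>))"
      using AE_finite_points[OF W]
    proof eventually_elim
      case (elim \<omega>)
      let ?F = "{j. x j \<omega> \<in> W}"
      have "infprod_except {} (\<lambda>j. 1 - of_bool (x j \<omega> \<in> W) * K (c (x j \<omega>))) = (\<Prod>j\<in>?F. 1 - K (c (x j \<omega>)))"
        using elim by (subst infprod_except_finite_support[of ?F]) auto
      also have "\<dots> = (\<Prod>k\<in>C. \<Prod>j\<in>{j\<in>?F. c (x j \<omega>) = k}. 1 - K (c (x j \<omega>)))"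
        using elim C by (intro prod.group[symmetric]) (auto simp: C_def)
      also have "\<dots> = (\<Prod>k\<in>C. (1 - K k) ^ point_count x (A k) \<omega>)"
        by (auto simp: point_count_def A_def intro!: prod.cong arg_cong[where f = card])
      finally show ?case
        using K by (simp add: prod_ennreal)
    qed
  qed
  also have "\<dots> = (\<Prod>k\<in>C. \<integral>\<^sup>+\<omega>. ennreal ((1 - K k) ^ point_count x (A k) \<omega>) \<partial>M)"
    using A C
    by (intro nn_integral_prod_point_count[where \<phi> = "\<lambda>k n. ennreal ((1 - K k) ^ n)"])
       (auto simp: disjoint_family_on_def A_def)
  also have "\<dots> = (\<Prod>k\<in>C. ennreal (exp (- (lam * measure lborel (A k) * K k))))"
    using A K by (subst nn_integral_power_point_count) auto
  also have "\<dots> = ennreal (exp (- lam * (\<Sum>k\<in>C. K k * measure lborel (A k))))"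
    using C by (simp add: prod_ennreal exp_sum[symmetric] sum_negf sum_distrib_left mult_ac)
  finally show ?thesis
    unfolding partition_integral[OF c W] C_def A_def .
qed

text \<open>Approximating \<open>g\<close> from below makes the factors \<open>1 - g\<close>
  decrease, which is the case in which limits pass through infinite products.\<close>

lemma laplace:
  fixes g :: "plane \<Rightarrow> real"
  assumes [measurable]: "g \<in> borel_measurable borel" and g: "\<And>z. 0 \<le> g z" "\<And>z. g z \<le> 1"
    and int: "integrable lborel g"
  shows "(\<integral>\<^sup>+\<omega>. ennreal (infprod_except {} (\<lambda>j. 1 - g (x j \<omega>))) \<partial>M) =
    ennreal (exp (- lam * (\<integral>z. g z \<partial>lborel)))"
proof -
  obtain f :: "nat \<Rightarrow> plane \<Rightarrow> real" where f: "incseq f" "\<And>i. simple_function borel (f i)"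
      "\<And>z. bdd_above (range (\<lambda>i. f i z))" "\<And>i z. 0 \<le> f i z" "g = (SUP i. f i)"
    using borel_measurable_implies_simple_function_sequence_real[of g borel] g by auto
  have inc: "incseq (\<lambda>i. f i z)" for z
    using f(1) by (auto simp: incseq_def le_fun_def)
  have lim: "(\<lambda>i. f i z) \<longlonglongrightarrow> g z" for z
    using LIMSEQ_incseq_SUP[OF f(3) inc] by (simp add: f(5) image_image)
  have fg: "f i z \<le> g z" for i z
    using incseq_le[OF inc lim] .
  have f1: "f i z \<le> 1" for i z
    using fg[of i z] g(2)[of z] by simp
  have [measurable]: "f i \<in> borel_measurable borel" for i
    using f(2) by (rule borel_measurable_simple_function)
  \<comment> \<open>The cut-off at radius \<open>i\<close> gives a bounded window, inside which
    there are almost surely only finitely many points.\<close>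
  define h where "h i z = of_bool (z \<in> cball 0 (real i)) * f i z" for i and z :: plane
  have [measurable]: "h i \<in> borel_measurable borel" for i
    unfolding h_def mem_cball by measurable
  have h: "0 \<le> h i z" "h i z \<le> 1" "h i z \<le> g z" "h i z \<le> h (Suc i) z" for i z
    using f(4)[of i z] f(4)[of "Suc i" z] f1 fg g incseq_SucD[OF inc, of i z] by (auto simp: h_def)
  have hlim: "(\<lambda>i. h i z) \<longlonglongrightarrow> g z" for z
  proof -
    have "\<forall>\<^sub>F i in sequentially. norm z \<le> real i"
      by real_asymp
    then have "\<forall>\<^sub>F i in sequentially. f i z = h i z"
      by eventually_elim (simp add: h_def)
    with lim show ?thesis
      by (rule Lim_transform_eventually)
  qed
  have lhs: "(\<lambda>i. \<integral>\<^sup>+\<omega>. ennreal (infprod_except {} (\<lambda>j. 1 - h i (x j \<omega>))) \<partial>M) \<longlonglongrightarrow>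
      (\<integral>\<^sup>+\<omega>. ennreal (infprod_except {} (\<lambda>j. 1 - g (x j \<omega>))) \<partial>M)"
    using h g hlim
    by (intro nn_integral_dominated_convergence[where w = "\<lambda>_. 1"] always_eventually allI tendsto_ennrealI
          infprod_except_decseq_tendsto tendsto_diff tendsto_const)
       (auto simp: emeasure_space_1 ennreal_le_1 intro!: infprod_except_bounds AE_I2)
  \<comment> \<open>The simple function \<open>f i\<close> is its own cell label. Clamping to the
    unit interval is the identity on its values; it is there because \<open>laplace_step\<close>
    asks for bounds at every real label.\<close>
  have eq: "(\<integral>\<^sup>+\<omega>. ennreal (infprod_except {} (\<lambda>j. 1 - h i (x j \<omega>))) \<partial>M) =
      ennreal (exp (- lam * (\<integral>z. h i z \<partial>lborel)))" for i
  proof -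
    have "(\<integral>\<^sup>+\<omega>. ennreal (infprod_except {} (\<lambda>j. 1 - of_bool (x j \<omega> \<in> cball 0 (real i)) * min 1 (max 0 (f i (x j \<omega>))))) \<partial>M) =
      ennreal (exp (- lam * (\<integral>z. of_bool (z \<in> cball 0 (real i)) * min 1 (max 0 (f i z)) \<partial>lborel)))"
      by (intro laplace_step[OF f(2), where K = "\<lambda>r. min 1 (max 0 r)"]) auto
    moreover have "min 1 (max 0 (f i z)) = f i z" for z
      using f(4) f1 by simp
    ultimately show ?thesis
      by (simp add: h_def)
  qed
  have "(\<lambda>i. \<integral>z. h i z \<partial>lborel) \<longlonglongrightarrow> (\<integral>z. g z \<partial>lborel)"
    using h g hlim int by (intro integral_dominated_convergence[where w = g]) auto
  then have rhs: "(\<lambda>i. ennreal (exp (- lam * (\<integral>z. h i z \<partial>lborel)))) \<longlonglongrightarrow> ennreal (exp (- lam * (\<integral>z. g z \<partial>lborel)))"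
    by (intro tendsto_ennrealI tendsto_intros)
  show ?thesis
    using LIMSEQ_unique[OF lhs[unfolded eq] rhs] .
qed

section \<open>Mecke formula for products over the other points\<close>

definition campbell_sum :: "(plane \<Rightarrow> plane \<Rightarrow> real) \<Rightarrow> plane set \<Rightarrow> 'w \<Rightarrow> ennreal" where
  "campbell_sum H B \<omega> =
     (\<Sum>i. ennreal (of_bool (x i \<omega> \<in> B) * infprod_except {i} (\<lambda>j. 1 - H (x i \<omega>) (x j \<omega>))))"

lemma campbell_sum_measurable[measurable]:
  assumes [measurable]: "(\<lambda>p. H (fst p) (snd p)) \<in> borel_measurable (borel \<Otimes>\<^sub>M borel)" "B \<in> sets borel"
  shows "campbell_sum H B \<in> borel_measurable M"
proof -
  have [measurable]: "(\<lambda>\<omega>. H (x i \<omega>) (x j \<omega>)) \<in> borel_measurable M" for i j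
    using measurable_compose[OF _ assms(1), of "\<lambda>\<omega>. (x i \<omega>, x j \<omega>)" M] by simp
  show ?thesis
    unfolding campbell_sum_def by measurable
qed

lemma campbell_sum_finite:
  assumes "finite {i. x i \<omega> \<in> B}" "\<And>u v. 0 \<le> H u v" "\<And>u v. H u v \<le> 1"
  shows "campbell_sum H B \<omega> =
    ennreal (\<Sum>i\<in>{i. x i \<omega> \<in> B}. infprod_except {i} (\<lambda>j. 1 - H (x i \<omega>) (x j \<omega>)))"
proof -
  have "campbell_sum H B \<omega> =
      (\<Sum>i\<in>{i. x i \<omega> \<in> B}. ennreal (of_bool (x i \<omega> \<in> B) * infprod_except {i} (\<lambda>j. 1 - H (x i \<omega>) (x j \<omega>))))"
    unfolding campbell_sum_def using assms(1) by (intro suminf_finite) auto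
  also have "\<dots> = (\<Sum>i\<in>{i. x i \<omega> \<in> B}. ennreal (infprod_except {i} (\<lambda>j. 1 - H (x i \<omega>) (x j \<omega>))))"
    by (intro sum.cong) auto
  finally show ?thesis
    using assms by (simp add: sum_ennreal infprod_except_bounds)
qed

text \<open>The Mecke formula for a product functional, with the Poisson expectation on the right
  already evaluated as a Laplace functional. In \<open>campbell_sum\<close> the device is left out
  by its index and not by its location, so another atom at the same place still counts as a
  contender.\<close>

definition mecke :: "(plane \<Rightarrow> plane \<Rightarrow> real) \<Rightarrow> plane set \<Rightarrow> bool" where
  "mecke H B \<longleftrightarrow> (\<integral>\<^sup>+\<omega>. campbell_sum H B \<omega> \<partial>M) =
     (\<integral>\<^sup>+u. ennreal (of_bool (u \<in> B) * (lam * exp (- lam * (\<integral>v. H u v \<partial>lborel)))) \<partial>lborel)"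

text \<open>Dominated convergence on both sides: the count in \<open>B\<close>, which has finite
  mean, dominates on the left, and \<open>lam\<close> times the indicator of \<open>B\<close> on the
  right. Convergence of the products is a hypothesis along almost every configuration, because it
  has different reasons in the two limits taken later.\<close>

lemma mecke_limit:
  assumes B: "B \<in> sets borel" "bounded B"
    and [measurable]: "\<And>n. (\<lambda>p. H n (fst p) (snd p)) \<in> borel_measurable (borel \<Otimes>\<^sub>M borel)"
      "(\<lambda>p. H' (fst p) (snd p)) \<in> borel_measurable (borel \<Otimes>\<^sub>M borel)"
    and H: "\<And>n u v. 0 \<le> H n u v" "\<And>n u v. H n u v \<le> 1"
    and H': "\<And>u v. 0 \<le> H' u v" "\<And>u v. H' u v \<le> 1"
    and lim: "AE \<omega> in M. \<forall>i. (\<lambda>n. infprod_except {i} (\<lambda>j. 1 - H n (x i \<omega>) (x j \<omega>))) \<longlonglongrightarrow>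
        infprod_except {i} (\<lambda>j. 1 - H' (x i \<omega>) (x j \<omega>))"
    and int: "\<And>u. (\<lambda>n. \<integral>v. H n u v \<partial>lborel) \<longlonglongrightarrow> (\<integral>v. H' u v \<partial>lborel)"
    and mecke: "\<And>n. mecke (H n) B"
  shows "mecke H' B"
proof -
  note [measurable] = B(1)
  have Bfin: "emeasure lborel B < \<infinity>"
    using B(2) by (rule emeasure_bounded_finite)
  have [measurable]: "point_count x B \<in> measurable M (count_space UNIV)"
    using B by (rule point_count_measurable)
  have "(\<lambda>n. \<integral>\<^sup>+\<omega>. campbell_sum (H n) B \<omega> \<partial>M) \<longlonglongrightarrow> (\<integral>\<^sup>+\<omega>. campbell_sum H' B \<omega> \<partial>M)"
  proof (rule nn_integral_dominated_convergence)
    show "AE \<omega> in M. campbell_sum (H n) B \<omega> \<le> ennreal (real (point_count x B \<omega>))" for n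
      using AE_finite_points[OF B]
    proof eventually_elim
      case (elim \<omega>)
      have "(\<Sum>i\<in>{i. x i \<omega> \<in> B}. infprod_except {i} (\<lambda>j. 1 - H n (x i \<omega>) (x j \<omega>))) \<le>
          (\<Sum>i\<in>{i. x i \<omega> \<in> B}. 1)"
        using H by (intro sum_mono infprod_except_bounds) auto
      then show ?case
        using elim H by (auto simp: campbell_sum_finite point_count_def intro!: ennreal_leI)
    qed
    show "(\<integral>\<^sup>+\<omega>. ennreal (real (point_count x B \<omega>)) \<partial>M) < \<infinity>"
      using nn_integral_deriv_power_point_count[OF B, of 1] by simp
    show "AE \<omega> in M. (\<lambda>n. campbell_sum (H n) B \<omega>) \<longlonglongrightarrow> campbell_sum H' B \<omega>"
      using AE_finite_points[OF B] lim
    proof eventually_elim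
      case (elim \<omega>)
      then show ?case
        using H H' by (auto simp: campbell_sum_finite intro!: tendsto_ennrealI tendsto_sum)
    qed
  qed measurable
  moreover have "(\<lambda>n. \<integral>\<^sup>+u. ennreal (of_bool (u \<in> B) * (lam * exp (- lam * (\<integral>v. H n u v \<partial>lborel)))) \<partial>lborel)
      \<longlonglongrightarrow> (\<integral>\<^sup>+u. ennreal (of_bool (u \<in> B) * (lam * exp (- lam * (\<integral>v. H' u v \<partial>lborel)))) \<partial>lborel)"
  proof (rule nn_integral_dominated_convergence)
    have meas: "(\<lambda>u. \<integral>v. G u v \<partial>lborel) \<in> borel_measurable borel"
      if "(\<lambda>p. G (fst p) (snd p)) \<in> borel_measurable (borel \<Otimes>\<^sub>M borel)" for G :: "plane \<Rightarrow> plane \<Rightarrow> real"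
      using that by (intro lborel.borel_measurable_lebesgue_integral) (simp add: case_prod_unfold cong: measurable_cong_sets sets_pair_measure_cong)
    note [measurable] = meas[of "H n" for n] meas[of H']
    show "(\<lambda>u. ennreal (of_bool (u \<in> B) * (lam * exp (- lam * (\<integral>v. H n u v \<partial>lborel))))) \<in> borel_measurable lborel" for n
      by measurable
    show "(\<lambda>u. ennreal (of_bool (u \<in> B) * (lam * exp (- lam * (\<integral>v. H' u v \<partial>lborel))))) \<in> borel_measurable lborel"
      by measurable
    show "AE u in lborel. ennreal (of_bool (u \<in> B) * (lam * exp (- lam * (\<integral>v. H n u v \<partial>lborel)))) \<le>
        ennreal lam * indicator B u" for n
    proof (intro AE_I2)
      fix u
      have "0 \<le> (\<integral>v. H n u v \<partial>lborel)"
        using H by (intro integral_nonneg_AE) auto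
      then show "ennreal (of_bool (u \<in> B) * (lam * exp (- lam * (\<integral>v. H n u v \<partial>lborel)))) \<le> ennreal lam * indicator B u"
        using lam_pos by (auto simp: indicator_def intro!: ennreal_leI mult_left_le)
    qed
    show "(\<integral>\<^sup>+u. ennreal lam * indicator B u \<partial>lborel) < \<infinity>"
      using Bfin by (simp add: nn_integral_cmult_indicator ennreal_mult_less_top)
    show "AE u in lborel. (\<lambda>n. ennreal (of_bool (u \<in> B) * (lam * exp (- lam * (\<integral>v. H n u v \<partial>lborel))))) \<longlonglongrightarrow>
        ennreal (of_bool (u \<in> B) * (lam * exp (- lam * (\<integral>v. H' u v \<partial>lborel))))"
      by (intro AE_I2 tendsto_ennrealI tendsto_intros int)
  qed measurable
  ultimately show ?thesis
    using mecke unfolding mecke_def by (simp add: LIMSEQ_unique)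
qed

text \<open>Every cell contributes the same exponential whether or not it holds the device; the cell
  of the device contributes in addition its mean count \<open>m k\<close>. Summing these means over
  the cells inside \<open>B\<close> gives back the integral over the position of the device. The
  predicate \<open>P\<close> says that \<open>B\<close> is cut out of \<open>W\<close> by labels, so
  that a cell lies in \<open>B\<close> as a whole or not at all.\<close>

lemma mecke_step:
  fixes c :: "plane \<Rightarrow> 'k" and K :: "'k \<Rightarrow> 'k \<Rightarrow> real"
  assumes c: "simple_function borel c" and W: "W \<in> sets borel" "bounded W"
    and K: "\<And>k k'. 0 \<le> K k k'" "\<And>k k'. K k k' \<le> 1"
    and B: "\<And>v. v \<in> B \<longleftrightarrow> v \<in> W \<and> P (c v)"
  shows "mecke (\<lambda>u v. of_bool (v \<in> W) * K (c u) (c v)) B"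
proof -
  define C where "C = range c"
  define A where "A k = W \<inter> c -` {k}" for k
  define H where "H u v = of_bool (v \<in> W) * K (c u) (c v)" for u v
  have C: "finite C"
    using simple_functionD(1)[OF c] by (simp add: C_def)
  have A: "A k \<in> sets borel" "bounded (A k)" for k
    using simple_functionD(2)[OF c, of "{k}"] W by (auto simp: A_def intro: bounded_subset)
  have dis: "disjoint_family_on A C"
    by (auto simp: disjoint_family_on_def A_def)
  have H: "0 \<le> H u v" "H u v \<le> 1" for u v
    using K by (auto simp: H_def)
  have BW: "B \<subseteq> W"
    using B by auto
  define N where "N k = point_count x (A k)" for k
  define m where "m k = lam * measure lborel (A k)" for k
  have m: "0 \<le> m k" for k
    using lam_pos by (simp add: m_def)
  \<comment> \<open>The cell of the device has lost one point to the device itself, and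
    \<open>real n\<close> counts the possible choices. For \<open>n = 0\<close> that factor is 0, so
    the truncated exponent does not matter.\<close>
  define \<phi> where "\<phi> k k' n = (if k' = k then real n * (1 - K k k') ^ (n - 1) else (1 - K k k') ^ n)" for k k' n
  have \<phi>: "0 \<le> \<phi> k k' n" for k k' n
    using K by (simp add: \<phi>_def)
  have meas_N: "N k \<in> measurable M (count_space UNIV)" for k
    unfolding N_def by (intro point_count_measurable A)
  have "(\<integral>\<^sup>+\<omega>. campbell_sum H B \<omega> \<partial>M) = 
      (\<integral>\<^sup>+\<omega>. (\<Sum>k\<in>C. of_bool (P k) * (\<Prod>k'\<in>C. ennreal (\<phi> k k' (N k' \<omega>)))) \<partial>M)"
  proof (rule nn_integral_cong_AE)
    show "AE \<omega> in M. campbell_sum H B \<omega> = (\<Sum>k\<in>C. of_bool (P k) * (\<Prod>k'\<in>C. ennreal (\<phi> k k' (N k' \<omega>))))"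
      using AE_finite_points[OF W]
    proof eventually_elim
      case (elim \<omega>)
      let ?F = "{j. x j \<omega> \<in> W}"
      have finB: "finite {i. x i \<omega> \<in> B}"
        using elim by (rule finite_subset[rotated]) (use BW in auto)
      have prod_group: "(\<Prod>j\<in>?F - {i}. 1 - K k (c (x j \<omega>))) =
          (\<Prod>k'\<in>C. (1 - K k k') ^ (N k' \<omega> - of_bool (k' = k)))"
        if i: "i \<in> ?F" "c (x i \<omega>) = k" for i k
      proof -
        have "(\<Prod>j\<in>?F - {i}. 1 - K k (c (x j \<omega>))) =
            (\<Prod>k'\<in>C. \<Prod>j\<in>{j\<in>?F - {i}. c (x j \<omega>) = k'}. 1 - K k (c (x j \<omega>)))"
          using elim C by (intro prod.group[symmetric]) (auto simp: C_def)
        also have "\<dots> = (\<Prod>k'\<in>C. (1 - K k k') ^ card {j\<in>?F - {i}. c (x j \<omega>) = k'})"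
          by (intro prod.cong) auto
        also have "\<dots> = (\<Prod>k'\<in>C. (1 - K k k') ^ (N k' \<omega> - of_bool (k' = k)))"
        proof (intro prod.cong refl arg_cong2[where f = power])
          fix k'
          have N: "N k' \<omega> = card {j\<in>?F. c (x j \<omega>) = k'}"
            by (auto simp: N_def point_count_def A_def intro!: arg_cong[where f = card])
          have "{j\<in>?F - {i}. c (x j \<omega>) = k'} = {j\<in>?F. c (x j \<omega>) = k'} - {i}"
            by auto
          moreover have "i \<in> {j\<in>?F. c (x j \<omega>) = k'} \<longleftrightarrow> k' = k"
            using i by auto
          ultimately show "card {j\<in>?F - {i}. c (x j \<omega>) = k'} = N k' \<omega> - of_bool (k' = k)"
            by (simp only: N card_Diff_singleton_if) simp
        qed
        finally show ?thesis .
      qed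
      \<comment> \<open>The number of choices is absorbed into the factor of cell \<open>k\<close>.
        What remains is a product of functions of one count each, the form to which independence
        applies.\<close>
      have prod_\<phi>: "real (N k \<omega>) * (\<Prod>k'\<in>C. (1 - K k k') ^ (N k' \<omega> - of_bool (k' = k))) =
          (\<Prod>k'\<in>C. \<phi> k k' (N k' \<omega>))" if "k \<in> C" for k
      proof -
        have "(\<Prod>k'\<in>C. \<phi> k k' (N k' \<omega>)) =
            (\<Prod>k'\<in>C. (if k' = k then real (N k' \<omega>) else 1) * (1 - K k k') ^ (N k' \<omega> - of_bool (k' = k)))"
          by (intro prod.cong) (auto simp: \<phi>_def)
        then show ?thesis
          using C that by (simp add: prod.distrib)
      qed
      have "(\<Sum>i\<in>{i. x i \<omega> \<in> B}. infprod_except {i} (\<lambda>j. 1 - H (x i \<omega>) (x j \<omega>))) =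
          (\<Sum>i\<in>{i. x i \<omega> \<in> B}. \<Prod>j\<in>?F - {i}. 1 - K (c (x i \<omega>)) (c (x j \<omega>)))"
        using elim by (intro sum.cong refl, subst infprod_except_finite_support[of ?F]) (auto simp: H_def)
      also have "\<dots> = (\<Sum>i\<in>?F. of_bool (P (c (x i \<omega>))) * (\<Prod>j\<in>?F - {i}. 1 - K (c (x i \<omega>)) (c (x j \<omega>))))"
        using elim B by (intro sum.mono_neutral_cong_left) auto
      also have "\<dots> = (\<Sum>k\<in>C. \<Sum>i\<in>{i\<in>?F. c (x i \<omega>) = k}.
          of_bool (P (c (x i \<omega>))) * (\<Prod>j\<in>?F - {i}. 1 - K (c (x i \<omega>)) (c (x j \<omega>))))"
        using elim C by (intro sum.group[symmetric]) (auto simp: C_def)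
      also have "\<dots> = (\<Sum>k\<in>C. \<Sum>i\<in>{i\<in>?F. c (x i \<omega>) = k}.
          of_bool (P k) * (\<Prod>k'\<in>C. (1 - K k k') ^ (N k' \<omega> - of_bool (k' = k))))"
        using prod_group by (intro sum.cong refl) auto
      also have "\<dots> = (\<Sum>k\<in>C. real (N k \<omega>) * (of_bool (P k) * (\<Prod>k'\<in>C. (1 - K k k') ^ (N k' \<omega> - of_bool (k' = k)))))"
        by (auto simp: N_def point_count_def A_def intro!: sum.cong arg_cong[where f = card])
      also have "\<dots> = (\<Sum>k\<in>C. of_bool (P k) * (\<Prod>k'\<in>C. \<phi> k k' (N k' \<omega>)))"
        using prod_\<phi> by (intro sum.cong refl) (simp add: mult.left_commute)
      moreover have "ennreal (of_bool b) = of_bool b" for b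
        by (cases b) auto
      ultimately show ?case
        using \<phi> by (simp add: campbell_sum_finite[OF finB] H sum_ennreal[symmetric] prod_nonneg
            ennreal_mult prod_ennreal[symmetric])
    qed
  qed
  also have "\<dots> = (\<Sum>k\<in>C. of_bool (P k) * (\<integral>\<^sup>+\<omega>. (\<Prod>k'\<in>C. ennreal (\<phi> k k' (N k' \<omega>))) \<partial>M))"
  proof -
    have [measurable]: "(\<lambda>\<omega>. \<phi> k k' (N k' \<omega>)) \<in> borel_measurable M" for k k'
      by (rule measurable_compose[OF meas_N]) simp
    show ?thesis
      by (subst nn_integral_sum) (auto simp: nn_integral_cmult)
  qed
  also have "\<dots> = (\<Sum>k\<in>C. of_bool (P k) * (\<Prod>k'\<in>C. \<integral>\<^sup>+\<omega>. ennreal (\<phi> k k' (N k' \<omega>)) \<partial>M))"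
    unfolding N_def
    by (subst nn_integral_prod_point_count[where \<phi> = "\<lambda>k' n. ennreal (\<phi> k k' n)" for k, OF C A dis]) simp
  also have "\<dots> = (\<Sum>k\<in>C. of_bool (P k) * ennreal (m k * exp (- (\<Sum>k'\<in>C. m k' * K k k'))))"
  proof (intro sum.cong refl arg_cong2[where f = "(*)"])
    fix k assume "k \<in> C"
    have "(\<integral>\<^sup>+\<omega>. ennreal (\<phi> k k' (N k' \<omega>)) \<partial>M) = ennreal ((if k' = k then m k' else 1) * exp (- (m k' * K k k')))" for k'
      using nn_integral_power_point_count[OF A, of "1 - K k k'" k']
        nn_integral_deriv_power_point_count[OF A, of "1 - K k k'" k'] K
      by (cases "k' = k") (simp_all add: \<phi>_def N_def m_def)
    then have "(\<Prod>k'\<in>C. \<integral>\<^sup>+\<omega>. ennreal (\<phi> k k' (N k' \<omega>)) \<partial>M) =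
        ennreal (\<Prod>k'\<in>C. (if k' = k then m k' else 1) * exp (- (m k' * K k k')))"
      using m by (simp add: prod_ennreal)
    also have "(\<Prod>k'\<in>C. (if k' = k then m k' else 1) * exp (- (m k' * K k k'))) =
        m k * exp (- (\<Sum>k'\<in>C. m k' * K k k'))"
      using C \<open>k \<in> C\<close> by (simp add: prod.distrib exp_sum sum_negf[symmetric])
    finally show "(\<Prod>k'\<in>C. \<integral>\<^sup>+\<omega>. ennreal (\<phi> k k' (N k' \<omega>)) \<partial>M) =
        ennreal (m k * exp (- (\<Sum>k'\<in>C. m k' * K k k')))" .
  qed
  \<comment> \<open>The mean \<open>m k\<close> is split: \<open>lam\<close> goes into the integrand
    and the area of the cell becomes a measure, so that the sum over cells is the integral of a
    function constant on cells.\<close>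
  also have "\<dots> = (\<Sum>k\<in>C. of_bool (P k) * ennreal (lam * exp (- lam * (\<Sum>k'\<in>C. K k k' * measure lborel (A k')))) *
      emeasure lborel (A k))"
  proof (intro sum.cong refl)
    fix k
    have "emeasure lborel (A k) = ennreal (measure lborel (A k))"
      using emeasure_bounded_finite[OF A(2)] by (intro emeasure_eq_ennreal_measure) (auto simp: less_top)
    then show "of_bool (P k) * ennreal (m k * exp (- (\<Sum>k'\<in>C. m k' * K k k'))) =
       of_bool (P k) * ennreal (lam * exp (- lam * (\<Sum>k'\<in>C. K k k' * measure lborel (A k')))) * emeasure lborel (A k)"
      using lam_pos by (simp add: m_def ennreal_mult[symmetric] mult_ac sum_distrib_left sum_negf)
  qed
  also have "\<dots> = (\<integral>\<^sup>+u. (\<Sum>k\<in>C. of_bool (P k) *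
      ennreal (lam * exp (- lam * (\<Sum>k'\<in>C. K k k' * measure lborel (A k')))) * indicator (A k) u) \<partial>lborel)"
    using A by (subst nn_integral_sum) (auto simp: nn_integral_cmult_indicator)
  also have "\<dots> = (\<integral>\<^sup>+u. ennreal (of_bool (u \<in> B) * (lam * exp (- lam * (\<integral>v. H u v \<partial>lborel)))) \<partial>lborel)"
  proof (rule nn_integral_cong)
    fix u
    let ?f = "\<lambda>k. of_bool (P k) * ennreal (lam * exp (- lam * (\<Sum>k'\<in>C. K k k' * measure lborel (A k'))))"
    have "(\<Sum>k\<in>C. ?f k * indicator (A k) u) = (\<Sum>k\<in>C. if c u = k then ?f (c u) * of_bool (u \<in> W) else 0)"
      by (intro sum.cong) (auto simp: A_def indicator_def)
    also have "\<dots> = ?f (c u) * of_bool (u \<in> W)"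
      using C by (simp add: C_def)
    also have "\<dots> = ennreal (of_bool (u \<in> B) * (lam * exp (- lam * (\<integral>v. H u v \<partial>lborel))))"
      unfolding H_def partition_integral[OF c W] using B[of u] by (auto simp: C_def A_def)
    finally show "(\<Sum>k\<in>C. ?f k * indicator (A k) u) =
        ennreal (of_bool (u \<in> B) * (lam * exp (- lam * (\<integral>v. H u v \<partial>lborel))))" .
  qed
  finally show ?thesis
    by (simp add: mecke_def H_def[abs_def])
qed

end

lemma lborel_shift:
  fixes g :: "'a::euclidean_space \<Rightarrow> real"
  assumes [measurable]: "g \<in> borel_measurable borel"
  shows integral_lborel_shift: "(\<integral>v. g (v - u) \<partial>lborel) = (\<integral>z. g z \<partial>lborel)"
    and integrable_lborel_shift: "integrable lborel g \<Longrightarrow> integrable lborel (\<lambda>v. g (v - u))"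
proof -
  have "(\<integral>z. g z \<partial>lborel) = (\<integral>z. g z \<partial>distr lborel borel ((+) (- u)))"
    by (simp add: lborel_distr_plus)
  then show "(\<integral>v. g (v - u) \<partial>lborel) = (\<integral>z. g z \<partial>lborel)"
    by (subst (asm) integral_distr) (auto simp: algebra_simps)
  assume "integrable lborel g"
  then have "integrable (distr lborel borel ((+) (- u))) g"
    by (simp add: lborel_distr_plus)
  then show "integrable lborel (\<lambda>v. g (v - u))"
    by (subst (asm) integrable_distr_eq) (auto simp: algebra_simps)
qed

context poisson_points
begin

text \<open>Two separate limits. Inside a bounded window the displacement is replaced by that of
  finite-valued approximations of the positions; these kernels are not monotone, but only finitely
  many factors occur and continuity of \<open>g\<close> off 0 suffices. Enlarging the window then
  involves infinitely many factors, but they decrease. A single passage to the limit would have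
  neither advantage.\<close>

lemma mecke_bounded:
  fixes g :: "plane \<Rightarrow> real"
  assumes [measurable]: "g \<in> borel_measurable borel" and g: "\<And>z. 0 \<le> g z" "\<And>z. g z \<le> 1"
    and g0: "g 0 = 0" and cont: "continuous_on (- {0}) g" and int: "integrable lborel g"
    and B: "B \<in> sets borel" "bounded B"
  shows "mecke (\<lambda>u v. g (v - u)) B"
proof -
  note [measurable] = B(1)
  obtain r where r: "\<And>z. z \<in> B \<Longrightarrow> norm z \<le> r"
    using B(2) by (auto simp: bounded_iff)
  have window: "mecke (\<lambda>u v. of_bool (v \<in> W) * g (v - u)) B"
    if W: "W \<in> sets borel" "bounded W" "B \<subseteq> W" for W
  proof -
    note [measurable] = W(1)
    obtain F :: "nat \<Rightarrow> plane \<Rightarrow> plane" where F: "\<And>i. simple_function borel (F i)" "\<And>z. (\<lambda>i. F i z) \<longlonglongrightarrow> z"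
      using borel_measurable_implies_sequence_metric[of "\<lambda>z :: plane. z" borel 0] by auto
    have [measurable]: "F i \<in> borel_measurable borel" for i
      using F(1) by (rule borel_measurable_simple_function)
    have B_pred: "(\<lambda>z. z \<in> B) \<in> measurable borel (count_space UNIV)"
      by measurable
    have "finite (range (\<lambda>z. z \<in> B))"
      by (rule finite_subset[OF subset_UNIV finite])
    then have "simple_function borel (\<lambda>z. z \<in> B)"
      using measurable_sets[OF B_pred] by (simp add: simple_function_def)
    \<comment> \<open>Membership in \<open>B\<close> is made part of the label, which turns
      \<open>B\<close> into a union of cells.\<close>
    then have c: "simple_function borel (\<lambda>v. (F i v, v \<in> B))" for i
      by (intro simple_function_Pair F(1))
    text \<open>
      At \<open>u = v\<close>, where \<open>g\<close> may be discontinuous, the sequence is constantly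
      \<open>g 0 = 0\<close>; hence simplicity of the point process is not needed.
    \<close>
    have lim: "(\<lambda>n. of_bool (v \<in> W) * g (F n v - F n u)) \<longlonglongrightarrow> of_bool (v \<in> W) * g (v - u)" for u v
    proof (cases "u = v")
      case False
      then have "isCont g (v - u)"
        using cont by (simp add: continuous_on_eq_continuous_at open_Compl)
      then show ?thesis
        by (intro tendsto_mult tendsto_const isCont_tendsto_compose[of _ g] tendsto_diff F(2))
    qed simp
    show ?thesis
    proof (rule mecke_limit[OF B, where H = "\<lambda>n u v. of_bool (v \<in> W) * g (F n v - F n u)"])
      show "mecke (\<lambda>u v. of_bool (v \<in> W) * g (F n v - F n u)) B" for n
        using mecke_step[OF c W(1,2), of "\<lambda>k k'. g (fst k' - fst k)" B snd n] g W(3) by auto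
      show "AE \<omega> in M. \<forall>i. (\<lambda>n. infprod_except {i} (\<lambda>j. 1 - of_bool (x j \<omega> \<in> W) * g (F n (x j \<omega>) - F n (x i \<omega>)))) \<longlonglongrightarrow>
          infprod_except {i} (\<lambda>j. 1 - of_bool (x j \<omega> \<in> W) * g (x j \<omega> - x i \<omega>))"
        using AE_finite_points[OF W(1,2)]
      proof eventually_elim
        case (elim \<omega>)
        have fin: "infprod_except {i} (\<lambda>j. 1 - of_bool (x j \<omega> \<in> W) * f j) =
            (\<Prod>j\<in>{j. x j \<omega> \<in> W} - {i}. 1 - of_bool (x j \<omega> \<in> W) * f j)" for i f
          using elim by (intro infprod_except_finite_support) auto
        show ?case
          unfolding fin by (intro allI tendsto_prod tendsto_diff tendsto_const lim)
      qed
      show "(\<lambda>n. \<integral>v. of_bool (v \<in> W) * g (F n v - F n u) \<partial>lborel) \<longlonglongrightarrow>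
          (\<integral>v. of_bool (v \<in> W) * g (v - u) \<partial>lborel)" for u
        using g emeasure_bounded_finite[OF W(2)]
        by (intro integral_dominated_convergence[where w = "indicator W"] AE_I2 lim)
           (auto simp: indicator_def intro!: integrable_real_indicator)
    qed (use g in auto)
  qed
  \<comment> \<open>Since \<open>r\<close> bounds the norms in \<open>B\<close>, every one of these
    windows contains \<open>B\<close>.\<close>
  define W where "W n = cball (0 :: plane) (r + real n)" for n
  have W: "\<exists>n0. \<forall>n\<ge>n0. z \<in> W n" for z
  proof -
    obtain n0 where "norm z - r \<le> real n0"
      using real_arch_simple by blast
    then show ?thesis
      by (intro exI[of _ n0]) (auto simp: W_def)
  qed
  have [measurable]: "W n \<in> sets borel" for n
    by (simp add: W_def)
  have lim: "(\<lambda>n. of_bool (v \<in> W n) * g (v - u)) \<longlonglongrightarrow> g (v - u)" for u v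
    using W[of v] by (intro tendsto_eventually) (auto simp: eventually_sequentially)
  show ?thesis
  proof (rule mecke_limit[OF B, where H = "\<lambda>n u v. of_bool (v \<in> W n) * g (v - u)"])
    show "mecke (\<lambda>u v. of_bool (v \<in> W n) * g (v - u)) B" for n
    proof (rule window)
      show "B \<subseteq> W n"
        by (auto simp: W_def dest!: r)
    qed (auto simp: W_def)
    show "AE \<omega> in M. \<forall>i. (\<lambda>n. infprod_except {i} (\<lambda>j. 1 - of_bool (x j \<omega> \<in> W n) * g (x j \<omega> - x i \<omega>))) \<longlonglongrightarrow>
        infprod_except {i} (\<lambda>j. 1 - g (x j \<omega> - x i \<omega>))"
      using g by (intro AE_I2 allI infprod_except_decseq_tendsto tendsto_diff tendsto_const lim) (auto simp: W_def)
    show "(\<lambda>n. \<integral>v. of_bool (v \<in> W n) * g (v - u) \<partial>lborel) \<longlonglongrightarrow> (\<integral>v. g (v - u) \<partial>lborel)" for u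
      using g by (intro integral_dominated_convergence[where w = "\<lambda>v. g (v - u)"] AE_I2 lim integrable_lborel_shift int) auto
  qed (use g in auto)
qed

text \<open>An arbitrary Borel set is exhausted by bounded ones. The sum stands outside the
  expectation because the marks are integrated index by index.\<close>

lemma mecke_formula:
  fixes g :: "plane \<Rightarrow> real"
  assumes [measurable]: "g \<in> borel_measurable borel" and g: "\<And>z. 0 \<le> g z" "\<And>z. g z \<le> 1"
    and g0: "g 0 = 0" and cont: "continuous_on (- {0}) g" and int: "integrable lborel g"
    and B: "B \<in> sets borel"
  shows "(\<Sum>i. \<integral>\<^sup>+\<omega>. ennreal (of_bool (x i \<omega> \<in> B) * infprod_except {i} (\<lambda>j. 1 - g (x j \<omega> - x i \<omega>))) \<partial>M) =
    ennreal (lam * exp (- lam * (\<integral>z. g z \<partial>lborel))) * emeasure lborel B"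
proof -
  note [measurable] = B
  define f where "f i \<omega> = infprod_except {i} (\<lambda>j. 1 - g (x j \<omega> - x i \<omega>))" for i \<omega>
  have [measurable]: "f i \<in> borel_measurable M" for i
    unfolding f_def by measurable
  have f: "0 \<le> f i \<omega>" for i \<omega>
    unfolding f_def using g by (intro infprod_except_bounds) auto
  define D where "D n = B \<inter> cball 0 (real n)" for n
  have D[measurable]: "D n \<in> sets borel" and D_bounded: "bounded (D n)" for n
    by (auto simp: D_def bounded_Int)
  have D_inc: "incseq D"
    by (auto simp: D_def incseq_def)
  have D_Union: "(\<Union>n. D n) = B"
    using real_arch_simple by (auto simp: D_def)
  have bounded: "(\<Sum>i. \<integral>\<^sup>+\<omega>. ennreal (of_bool (x i \<omega> \<in> D n) * f i \<omega>) \<partial>M) =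
      ennreal (lam * exp (- lam * (\<integral>z. g z \<partial>lborel))) * emeasure lborel (D n)" for n
  proof -
    have "(\<Sum>i. \<integral>\<^sup>+\<omega>. ennreal (of_bool (x i \<omega> \<in> D n) * f i \<omega>) \<partial>M) =
        (\<integral>\<^sup>+\<omega>. campbell_sum (\<lambda>u v. g (v - u)) (D n) \<omega> \<partial>M)"
      unfolding campbell_sum_def f_def[symmetric] by (subst nn_integral_suminf) auto
    also have "\<dots> = (\<integral>\<^sup>+u. ennreal (lam * exp (- lam * (\<integral>z. g z \<partial>lborel))) * indicator (D n) u \<partial>lborel)"
      using mecke_bounded[OF assms(1) g g0 cont int D D_bounded, of n]
      unfolding mecke_def integral_lborel_shift[OF assms(1)] by (auto intro!: nn_integral_cong simp: indicator_def)
    finally show ?thesis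
      by (simp add: nn_integral_cmult_indicator)
  qed
  \<comment> \<open>With the series written as an integral over counting measure, monotone
    convergence serves for the sum as well as for the expectation.\<close>
  have lhs: "(\<lambda>n. \<integral>\<^sup>+i. \<integral>\<^sup>+\<omega>. ennreal (of_bool (x i \<omega> \<in> D n) * f i \<omega>) \<partial>M \<partial>count_space UNIV) \<longlonglongrightarrow>
      (\<integral>\<^sup>+i. \<integral>\<^sup>+\<omega>. ennreal (of_bool (x i \<omega> \<in> B) * f i \<omega>) \<partial>M \<partial>count_space UNIV)"
  proof (rule nn_integral_LIMSEQ)
    have mono: "ennreal (of_bool (x i \<omega> \<in> D m) * f i \<omega>) \<le> ennreal (of_bool (x i \<omega> \<in> D n) * f i \<omega>)"
      if "m \<le> n" for m n i \<omega>
      using f[of i \<omega>] incseqD[OF D_inc that] by (auto intro!: ennreal_leI)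
    then show "incseq (\<lambda>n i. \<integral>\<^sup>+\<omega>. ennreal (of_bool (x i \<omega> \<in> D n) * f i \<omega>) \<partial>M)"
      by (auto simp: incseq_def le_fun_def intro!: nn_integral_mono)
    show "(\<lambda>n. \<integral>\<^sup>+\<omega>. ennreal (of_bool (x i \<omega> \<in> D n) * f i \<omega>) \<partial>M) \<longlonglongrightarrow>
        (\<integral>\<^sup>+\<omega>. ennreal (of_bool (x i \<omega> \<in> B) * f i \<omega>) \<partial>M)" for i
    proof (rule nn_integral_LIMSEQ)
      show "incseq (\<lambda>n \<omega>. ennreal (of_bool (x i \<omega> \<in> D n) * f i \<omega>))"
        using mono by (auto simp: incseq_def le_fun_def)
      show "(\<lambda>n. ennreal (of_bool (x i \<omega> \<in> D n) * f i \<omega>)) \<longlonglongrightarrow> ennreal (of_bool (x i \<omega> \<in> B) * f i \<omega>)" for \<omega>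
      proof -
        obtain n0 where "norm (x i \<omega>) \<le> real n0"
          using real_arch_simple by blast
        then have "\<forall>n\<ge>n0. (x i \<omega> \<in> D n) = (x i \<omega> \<in> B)"
          by (auto simp: D_def)
        then show ?thesis
          by (intro tendsto_eventually) (auto simp: eventually_sequentially)
      qed
    qed measurable
  qed simp
  have rhs: "(\<lambda>n. ennreal (lam * exp (- lam * (\<integral>z. g z \<partial>lborel))) * emeasure lborel (D n)) \<longlonglongrightarrow>
      ennreal (lam * exp (- lam * (\<integral>z. g z \<partial>lborel))) * emeasure lborel B"
    using Lim_emeasure_incseq[of D lborel] D_inc D_Union D
    by (intro ennreal_tendsto_cmult) (auto simp: image_subset_iff)
  have "(\<lambda>n. ennreal (lam * exp (- lam * (\<integral>z. g z \<partial>lborel))) * emeasure lborel (D n)) \<longlonglongrightarrow>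
      (\<Sum>i. \<integral>\<^sup>+\<omega>. ennreal (of_bool (x i \<omega> \<in> B) * f i \<omega>) \<partial>M)"
    using lhs by (simp only: nn_integral_count_space_nat bounded)
  from LIMSEQ_unique[OF this rhs] show ?thesis
    by (simp only: f_def)
qed

end

subsection \<open>Sensing probability\<close>

text \<open>
  The probability that a transmitter at displacement \<open>z\<close> is sensed.  At \<open>z = 0\<close> the
  received power \<open>G / l 0\<close> is the junk value 0, which never exceeds the threshold.
\<close>

definition sensing_prob :: "real \<Rightarrow> real \<Rightarrow> plane \<Rightarrow> real" where
  "sensing_prob c \<alpha> z = (if z = 0 then 0 else exp (- c * norm z powr \<alpha>))"

lemma sensing_prob_measurable[measurable]: "sensing_prob c \<alpha> \<in> borel_measurable borel"
  unfolding sensing_prob_def by measurable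

lemma sensing_prob_bounds:
  "0 \<le> sensing_prob c \<alpha> z" "0 \<le> c \<Longrightarrow> sensing_prob c \<alpha> z \<le> 1"
  by (auto simp: sensing_prob_def)

lemma continuous_on_sensing_prob: "continuous_on (- {0}) (sensing_prob c \<alpha>)"
proof -
  have "continuous_on (- {0}) (\<lambda>z :: plane. exp (- c * norm z powr \<alpha>))"
    by (intro continuous_intros) auto
  then show ?thesis
    by (rule continuous_on_cong[THEN iffD1, rotated -1]) (auto simp: sensing_prob_def)
qed

text \<open>On the annulus of norms between \<open>n\<close> and \<open>n + 1\<close> the integrand
  is at most its value at radius \<open>n\<close>, and the annulus is contained in a disc of area
  \<open>V * (n + 1) ^ 2\<close>. The stretched exponential beats this quadratic growth for every
  positive \<alpha>.\<close>

lemma integrable_exp_neg_norm_powr: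
  fixes c \<alpha> :: real
  assumes "0 < c" "0 < \<alpha>"
  shows "integrable lborel (\<lambda>z :: plane. exp (- c * norm z powr \<alpha>))"
proof (rule integrableI_bounded)
  define Q where "Q n = cball (0 :: plane) (real n + 1)" for n
  have [measurable]: "Q n \<in> sets borel" for n
    by (simp add: Q_def)
  define V where "V = unit_ball_vol 2"
  define a where "a n = exp (- c * real n powr \<alpha>) * (V * (real n + 1) ^ 2)" for n
  have V: "0 \<le> V"
    by (simp add: V_def)
  have a: "0 \<le> a n" for n
    using V by (simp add: a_def)
  have "(\<lambda>n. exp (- c * real n powr \<alpha>) * (real n + 1) ^ 2) \<in> O(\<lambda>n. 1 / real n ^ 2)"
    using assms by real_asymp
  then have "summable (\<lambda>n. exp (- c * real n powr \<alpha>) * (real n + 1) ^ 2)"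
    by (rule summable_comparison_test_bigo[rotated])
       (use inverse_power_summable[of 2, where 'a = real] in \<open>simp add: divide_inverse\<close>)
  then have "summable (\<lambda>n. V * (exp (- c * real n powr \<alpha>) * (real n + 1) ^ 2))"
    by (rule summable_mult)
  then have sum_a: "summable a"
    by (simp add: a_def[abs_def] mult_ac)
  have "(\<integral>\<^sup>+z. ennreal (norm (exp (- c * norm (z :: plane) powr \<alpha>))) \<partial>lborel) \<le>
      (\<integral>\<^sup>+z. (\<Sum>n. ennreal (exp (- c * real n powr \<alpha>)) * indicator (Q n) z) \<partial>lborel)"
  proof (rule nn_integral_mono)
    fix z :: plane
    \<comment> \<open>The majorant sums over all discs containing \<open>z\<close>; its single term
      for the annulus of \<open>z\<close> is already large enough.\<close>
    define n where "n = nat \<lfloor>norm z\<rfloor>"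
    have n: "real n \<le> norm z" "norm z \<le> real n + 1"
      unfolding n_def by (linarith | simp)+
    have "ennreal (norm (exp (- c * norm z powr \<alpha>))) \<le> ennreal (exp (- c * real n powr \<alpha>))"
      using assms n by (auto intro!: ennreal_leI powr_mono2)
    also have "\<dots> = (\<Sum>n\<in>{n}. ennreal (exp (- c * real n powr \<alpha>)) * indicator (Q n) z)"
      using n by (simp add: Q_def)
    also have "\<dots> \<le> (\<Sum>n. ennreal (exp (- c * real n powr \<alpha>)) * indicator (Q n) z)"
      by (rule sum_le_suminf) auto
    finally show "ennreal (norm (exp (- c * norm z powr \<alpha>))) \<le>
        (\<Sum>n. ennreal (exp (- c * real n powr \<alpha>)) * indicator (Q n) z)" .
  qed
  also have "\<dots> = (\<Sum>n. ennreal (exp (- c * real n powr \<alpha>)) * emeasure lborel (Q n))"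
    by (subst nn_integral_suminf) (simp_all add: nn_integral_cmult_indicator)
  also have "\<dots> = (\<Sum>n. ennreal (a n))"
  proof (intro suminf_cong)
    fix n
    have "emeasure lborel (Q n) = ennreal (V * (real n + 1) ^ 2)"
      by (simp add: Q_def emeasure_cball V_def)
    then show "ennreal (exp (- c * real n powr \<alpha>)) * emeasure lborel (Q n) = ennreal (a n)"
      using V unfolding a_def by (subst ennreal_mult) auto
  qed
  also have "\<dots> < \<infinity>"
    using suminf_ennreal2[OF a sum_a] by simp
  finally show "(\<integral>\<^sup>+z. ennreal (norm (exp (- c * norm (z :: plane) powr \<alpha>))) \<partial>lborel) < \<infinity>" .
qed measurable

lemma AE_sensing_prob: "AE z in lborel. sensing_prob c \<alpha> z = exp (- c * norm z powr \<alpha>)"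
  using AE_lborel_singleton[of 0] by eventually_elim (simp add: sensing_prob_def)

lemma integrable_sensing_prob:
  assumes "0 < c" "0 < \<alpha>"
  shows "integrable lborel (sensing_prob c \<alpha>)"
proof (rule integrable_cong_AE_imp[OF integrable_exp_neg_norm_powr[OF assms]])
  show "AE z in lborel. exp (- c * norm z powr \<alpha>) = sensing_prob c \<alpha> z"
    using AE_sensing_prob[of c \<alpha>] by eventually_elim (rule sym)
qed measurable

lemma integral_sensing_prob:
  "(\<integral>z. sensing_prob c \<alpha> z \<partial>lborel) = (\<integral>z. exp (- c * norm (z :: plane) powr \<alpha>) \<partial>lborel)"
  by (intro integral_cong_AE AE_sensing_prob) measurable

text \<open>A nonnegative function with integral 0 vanishes almost everywhere, but an exponential
  vanishes nowhere. This ensures that the denominator of the access probability is positive.\<close>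

lemma integral_exp_neg_norm_powr_pos:
  assumes "0 < c" "0 < \<alpha>"
  shows "0 < (\<integral>z. exp (- c * norm (z :: plane) powr \<alpha>) \<partial>lborel)"
proof -
  have "(\<integral>z. exp (- c * norm (z :: plane) powr \<alpha>) \<partial>lborel) \<noteq> 0"
  proof
    assume "(\<integral>z. exp (- c * norm (z :: plane) powr \<alpha>) \<partial>lborel) = 0"
    then have "AE z :: plane in lborel. exp (- c * norm z powr \<alpha>) = 0"
      using integrable_exp_neg_norm_powr[OF assms] by (subst (asm) integral_nonneg_eq_0_iff_AE) auto
    then have "AE z :: plane in lborel. False"
      by simp
    then show False
      by (simp add: AE_iff_measurable[of UNIV] emeasure_lborel_UNIV)
  qed
  moreover have "0 \<le> (\<integral>z. exp (- c * norm (z :: plane) powr \<alpha>) \<partial>lborel)"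
    by (intro integral_nonneg_AE) auto
  ultimately show ?thesis
    by linarith
qed

subsection \<open>Medium access in the network\<close>

lemma Int_stable_generated_sigma: "Int_stable (generated_sigma M X N)"
proof (rule Int_stableI)
  fix a b assume "a \<in> generated_sigma M X N" "b \<in> generated_sigma M X N"
  then obtain A B where AB: "a = X -` A \<inter> space M" "A \<in> sets N" "b = X -` B \<inter> space M" "B \<in> sets N"
    by (auto simp: generated_sigma_def)
  then have "a \<inter> b = X -` (A \<inter> B) \<inter> space M" "A \<inter> B \<in> sets N"
    by auto
  then show "a \<inter> b \<in> generated_sigma M X N"
    unfolding generated_sigma_def by blast
qed

lemma Int_stable_source_sigma: "Int_stable (source_sigma M x y tW tL GW GLW GWL GL s)"
  by (cases s) (simp_all add: Int_stable_generated_sigma)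

lemma measurable_sigma_Union_generated:
  assumes X: "X \<in> measurable M N" and s: "s \<in> S" "E s = generated_sigma M X N"
    and E: "\<And>s. E s \<subseteq> Pow (space M)"
  shows "X \<in> measurable (sigma (space M) (\<Union>s\<in>S. E s)) N"
proof (rule measurableI)
  have sp: "(\<Union>s\<in>S. E s) \<subseteq> Pow (space M)"
    using E by blast
  fix A assume "A \<in> sets N"
  then have "X -` A \<inter> space M \<in> (\<Union>s\<in>S. E s)"
    using s by (auto simp: generated_sigma_def)
  then show "X -` A \<inter> space (sigma (space M) (\<Union>s\<in>S. E s)) \<in> sets (sigma (space M) (\<Union>s\<in>S. E s))"
    using sp by (simp add: space_measure_of sets_measure_of sigma_sets.Basic)
next
  fix \<omega> assume "\<omega> \<in> space (sigma (space M) (\<Union>s\<in>S. E s))"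
  then show "X \<omega> \<in> space N"
    using measurable_space[OF X] E by (auto simp: space_measure_of_conv)
qed

text \<open>The distribution function of the uniform law on [0, 1]. It stands in for
  \<open>t\<close> because a timer lies in the unit interval only almost surely, while the
  identities and bounds below hold at every outcome.\<close>

definition clamp01 :: "real \<Rightarrow> real" where
  "clamp01 t = max 0 (min 1 t)"

lemma clamp01_measurable[measurable]: "clamp01 \<in> borel_measurable borel"
  unfolding clamp01_def by measurable

lemma clamp01_bounds: "0 \<le> clamp01 t" "clamp01 t \<le> 1"
  by (auto simp: clamp01_def)

lemma (in prob_space) prob_uniform_less:
  assumes "distributed M lborel T (indicator {0..1})"
  shows "prob {\<omega>\<in>space M. T \<omega> < t} = clamp01 t"
proof -
  have "emeasure M {\<omega>\<in>space M. T \<omega> < t} = emeasure M (T -` {..<t} \<inter> space M)"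
    by (intro arg_cong[where f = "emeasure M"]) auto
  also have "\<dots> = (\<integral>\<^sup>+s. indicator {0..1} s * indicator {..<t} s \<partial>lborel)"
    by (rule distributed_emeasure[OF assms]) simp
  also have "\<dots> = emeasure lborel ({0..1} \<inter> {..<t})"
    by (subst nn_integral_indicator[symmetric], simp, intro nn_integral_cong) (simp add: indicator_inter_arith)
  also have "{0..1} \<inter> {..<t} = (if t \<le> 1 then {0..<t} else {0..1})"
    by auto
  also have "emeasure lborel \<dots> = ennreal (clamp01 t)"
    by (auto simp: clamp01_def max_def min_def ennreal_neg)
  finally show ?thesis
    by (simp add: measure_def clamp01_bounds)
qed

text \<open>The devices whose access is studied are the points of \<open>x\<close>, and the fading
  laws fixed here are those of signals received by them. With the arguments exchanged the same
  locale describes the eNBs as devices.\<close>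

locale lbt_network = prob_space M for M :: "'w measure" +
  fixes x y :: "nat \<Rightarrow> 'w \<Rightarrow> plane"
    and tW tL :: "nat \<Rightarrow> 'w \<Rightarrow> real"
    and GW GLW GWL GL :: "nat \<Rightarrow> nat \<Rightarrow> 'w \<Rightarrow> real"
    and lam_W lam_L lam_c \<alpha> \<mu> :: real
  assumes pos: "0 < lam_W" "0 < lam_L" "0 < lam_c" "0 < \<alpha>" "0 < \<mu>"
    and ppp_W: "homogeneous_ppp M lam_W x"
    and ppp_L: "homogeneous_ppp M lam_L y"
    and timer_W: "\<And>i. distributed M lborel (tW i) (indicator {0..1})"
    and timer_L: "\<And>k. distributed M lborel (tL k) (indicator {0..1})"
    and fading_W: "\<And>j i. distributed M lborel (GW j i) (exponential_density \<mu>)"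
    and fading_LW: "\<And>m i. distributed M lborel (GLW m i) (exponential_density \<mu>)"
    and indep: "indep_sets (source_sigma M x y tW tL GW GLW GWL GL) UNIV"
begin

sublocale W: poisson_points M lam_W x
  by unfold_locales (use pos ppp_W in auto)

sublocale L: poisson_points M lam_L y
  by unfold_locales (use pos ppp_L in auto)

text \<open>Measurability with respect to \<open>Sg S\<close> encodes that a quantity is a function
  of the sources in \<open>S\<close>; disjoint sets of sources then give independence.\<close>

definition Sg :: "source set \<Rightarrow> 'w measure" where
  "Sg S = sigma (space M) (\<Union>s\<in>S. source_sigma M x y tW tL GW GLW GWL GL s)"

lemma source_sigma_subset: "source_sigma M x y tW tL GW GLW GWL GL s \<subseteq> Pow (space M)"
  using indep sets.space_closed[of M] by (auto simp: indep_sets_def)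

lemma indep_pair_Sg:
  assumes "A \<in> measurable (Sg I) S" "V \<in> measurable (Sg K) T" "I \<inter> K = {}"
  shows "indep_pair S A T V"
  using assms unfolding Sg_def
  by (intro indep_pair_disjoint_sources[OF indep Int_stable_source_sigma])

lemma space_Sg: "space (Sg S) = space M"
  by (simp add: Sg_def space_measure_of_conv)

lemma measurable_Sg_mono:
  assumes "X \<in> measurable (Sg S) N" "S \<subseteq> S'"
  shows "X \<in> measurable (Sg S') N"
proof -
  have sp: "(\<Union>s\<in>L. source_sigma M x y tW tL GW GLW GWL GL s) \<subseteq> Pow (space M)" for L
    using source_sigma_subset by blast
  have "sets (Sg S) \<subseteq> sets (Sg S')"
    unfolding Sg_def using sp assms(2)
    by (simp only: sets_measure_of, intro sigma_sets_mono') blast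
  then show ?thesis
    using assms(1) by (auto simp: measurable_def space_Sg)
qed

lemma real_measurable[measurable]:
  "tW i \<in> borel_measurable M" "tL k \<in> borel_measurable M"
  "GW j i \<in> borel_measurable M" "GLW m i \<in> borel_measurable M"
  using distributed_measurable[OF timer_W] distributed_measurable[OF timer_L]
    distributed_measurable[OF fading_W] distributed_measurable[OF fading_LW]
  by simp_all

lemma Sg_measurable:
  "AP_points \<in> S \<Longrightarrow> x i \<in> borel_measurable (Sg S)"
  "ENB_points \<in> S \<Longrightarrow> y k \<in> borel_measurable (Sg S)"
  "AP_timer i \<in> S \<Longrightarrow> tW i \<in> borel_measurable (Sg S)"
  "ENB_timer k \<in> S \<Longrightarrow> tL k \<in> borel_measurable (Sg S)"
  "Fading_W j i \<in> S \<Longrightarrow> GW j i \<in> borel_measurable (Sg S)"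
  "Fading_LW m i \<in> S \<Longrightarrow> GLW m i \<in> borel_measurable (Sg S)"
  and Sg_points_measurable:
  "AP_points \<in> S \<Longrightarrow> (\<lambda>\<omega> i. x i \<omega>) \<in> measurable (Sg S) (Pi\<^sub>M UNIV (\<lambda>_. borel))"
  "ENB_points \<in> S \<Longrightarrow> (\<lambda>\<omega> k. y k \<omega>) \<in> measurable (Sg S) (Pi\<^sub>M UNIV (\<lambda>_. borel))"
proof -
  show points_x: "(\<lambda>\<omega> i. x i \<omega>) \<in> measurable (Sg S) (Pi\<^sub>M UNIV (\<lambda>_. borel))" if "AP_points \<in> S"
    unfolding Sg_def
    by (rule measurable_sigma_Union_generated[where s = AP_points])
       (use that source_sigma_subset in \<open>auto intro!: measurable_PiM_single'\<close>)
  show points_y: "(\<lambda>\<omega> k. y k \<omega>) \<in> measurable (Sg S) (Pi\<^sub>M UNIV (\<lambda>_. borel))" if "ENB_points \<in> S"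
    unfolding Sg_def
    by (rule measurable_sigma_Union_generated[where s = ENB_points])
       (use that source_sigma_subset in \<open>auto intro!: measurable_PiM_single'\<close>)
  show "x i \<in> borel_measurable (Sg S)" if "AP_points \<in> S"
    using measurable_compose[OF points_x[OF that] measurable_component_singleton[of i]] by simp
  show "y k \<in> borel_measurable (Sg S)" if "ENB_points \<in> S"
    using measurable_compose[OF points_y[OF that] measurable_component_singleton[of k]] by simp
  have gen: "V \<in> borel_measurable (Sg S)"
    if "s \<in> S" "source_sigma M x y tW tL GW GLW GWL GL s = generated_sigma M V borel" "V \<in> borel_measurable M"
    for V :: "'w \<Rightarrow> real" and s
    unfolding Sg_def by (rule measurable_sigma_Union_generated[where E = "source_sigma M x y tW tL GW GLW GWL GL" and S = S and s = s,
          OF that(3,1,2) source_sigma_subset])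
  show "AP_timer i \<in> S \<Longrightarrow> tW i \<in> borel_measurable (Sg S)"
    "ENB_timer k \<in> S \<Longrightarrow> tL k \<in> borel_measurable (Sg S)"
    "Fading_W j i \<in> S \<Longrightarrow> GW j i \<in> borel_measurable (Sg S)"
    "Fading_LW m i \<in> S \<Longrightarrow> GLW m i \<in> borel_measurable (Sg S)"
    by (erule gen; simp)+
qed

text \<open>The factor is 1 minus the product of two indicators: the contender's timer is smaller,
  and its signal exceeds the threshold. The fading is averaged with the timer indicator frozen, so
  the timer source joins \<open>S\<close> at that stage; the timer is averaged afterwards, with the
  sensing probability as its coefficient.\<close>

lemma replace_contender:
  assumes T: "T \<in> borel_measurable (Sg {sT})" "distributed M lborel T (indicator {0..1})"
    and G: "G \<in> borel_measurable (Sg {sG})" "distributed M lborel G (exponential_density \<mu>)"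
    and ne: "sT \<noteq> sG"
    and S: "S \<subseteq> - {sT, sG}"
    and \<Phi>: "\<Phi> \<in> borel_measurable (Sg S)" "\<And>\<omega>. 0 \<le> \<Phi> \<omega>"
    and \<tau>: "\<tau> \<in> borel_measurable (Sg S)" and b: "b \<in> borel_measurable (Sg S)"
    and \<theta>: "0 < \<theta>"
  shows "(\<integral>\<^sup>+\<omega>. ennreal (\<Phi> \<omega> * lbt_factor (\<tau> \<omega>) (T \<omega>) (G \<omega> / path_loss lam_c \<alpha> (norm (b \<omega> :: plane))) \<theta>) \<partial>M) =
    (\<integral>\<^sup>+\<omega>. ennreal (\<Phi> \<omega> * (1 - clamp01 (\<tau> \<omega>) * sensing_prob (\<mu> * \<theta> * (4 * pi / lam_c)\<^sup>2) \<alpha> (b \<omega>))) \<partial>M)"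
proof -
  define p where "p = sensing_prob (\<mu> * \<theta> * (4 * pi / lam_c)\<^sup>2) \<alpha>"
  have [measurable]: "p \<in> borel_measurable borel"
    unfolding p_def by measurable
  have p: "0 \<le> p z" "p z \<le> 1" for z
    using pos \<theta> by (auto simp: p_def intro!: sensing_prob_bounds)
  have [measurable]: "path_loss lam_c \<alpha> \<in> borel_measurable borel"
    unfolding path_loss_def by measurable
  have prob_G: "prob {\<omega>'\<in>space M. \<theta> < G \<omega>' / path_loss lam_c \<alpha> (norm z)} = p z" for z :: plane
  proof (cases "z = 0")
    case True
    then show ?thesis
      using \<theta> by (simp add: path_loss_def p_def sensing_prob_def)
  next
    case False
    then have l: "0 < path_loss lam_c \<alpha> (norm z)"
      using pos by (simp add: path_loss_def)
    then have "{\<omega>'\<in>space M. \<theta> < G \<omega>' / path_loss lam_c \<alpha> (norm z)} =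
        {\<omega>'\<in>space M. \<theta> * path_loss lam_c \<alpha> (norm z) < G \<omega>'}"
      by (auto simp: field_simps)
    then show ?thesis
      using exponential_distributedD_gt[OF G(2), of "\<theta> * path_loss lam_c \<alpha> (norm z)"] l \<theta> pos False
      by (simp add: p_def sensing_prob_def path_loss_def mult_ac)
  qed
  have "(\<integral>\<^sup>+\<omega>. ennreal (\<Phi> \<omega> * lbt_factor (\<tau> \<omega>) (T \<omega>) (G \<omega> / path_loss lam_c \<alpha> (norm (b \<omega>))) \<theta>) \<partial>M) =
      (\<integral>\<^sup>+\<omega>. ennreal (\<Phi> \<omega> * (1 - of_bool (T \<omega> < \<tau> \<omega>) * of_bool (\<theta> < G \<omega> / path_loss lam_c \<alpha> (norm (b \<omega>))))) \<partial>M)"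
    by (intro nn_integral_cong) (auto simp: lbt_factor_def)
  also have "\<dots> = (\<integral>\<^sup>+\<omega>. ennreal (\<Phi> \<omega> * (1 - of_bool (T \<omega> < \<tau> \<omega>) *
      prob {\<omega>'\<in>space M. \<theta> < G \<omega>' / path_loss lam_c \<alpha> (norm (b \<omega>))})) \<partial>M)"
  proof (rule nn_integral_thin[where Q = "\<lambda>z v. \<theta> < v / path_loss lam_c \<alpha> (norm z)" and b = b and N = borel and L = borel])
    have [measurable]: "T \<in> borel_measurable (Sg (insert sT S))"
      by (rule measurable_Sg_mono[OF T(1)]) simp
    note [measurable] = measurable_Sg_mono[OF \<Phi>(1) subset_insertI] measurable_Sg_mono[OF \<tau> subset_insertI]
      measurable_Sg_mono[OF b subset_insertI]
    show "indep_pair (borel \<Otimes>\<^sub>M borel \<Otimes>\<^sub>M borel) (\<lambda>\<omega>. (\<Phi> \<omega>, of_bool (T \<omega> < \<tau> \<omega>), b \<omega>)) borel G"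
    proof (rule indep_pair_Sg[OF _ G(1)])
      show "(\<lambda>\<omega>. (\<Phi> \<omega>, of_bool (T \<omega> < \<tau> \<omega>), b \<omega>)) \<in> measurable (Sg (insert sT S)) (borel \<Otimes>\<^sub>M borel \<Otimes>\<^sub>M borel)"
        by measurable
    qed (use ne S in auto)
    show "Measurable.pred (borel \<Otimes>\<^sub>M borel) (\<lambda>p. \<theta> < snd p / path_loss lam_c \<alpha> (norm (fst p :: plane)))"
      by measurable
  qed (use \<Phi> in auto)
  also have "\<dots> = (\<integral>\<^sup>+\<omega>. ennreal (\<Phi> \<omega> * (1 - p (b \<omega>) * of_bool (T \<omega> < \<tau> \<omega>))) \<partial>M)"
    by (simp add: prob_G mult.commute)
  also have "\<dots> = (\<integral>\<^sup>+\<omega>. ennreal (\<Phi> \<omega> * (1 - p (b \<omega>) * prob {\<omega>'\<in>space M. T \<omega>' < \<tau> \<omega>})) \<partial>M)"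
  proof (rule nn_integral_thin[where Q = "\<lambda>t v. v < t" and b = \<tau> and N = borel and L = borel])
    note [measurable] = \<Phi>(1) \<tau> b
    show "indep_pair (borel \<Otimes>\<^sub>M borel \<Otimes>\<^sub>M borel) (\<lambda>\<omega>. (\<Phi> \<omega>, p (b \<omega>), \<tau> \<omega>)) borel T"
    proof (rule indep_pair_Sg[OF _ T(1)])
      show "(\<lambda>\<omega>. (\<Phi> \<omega>, p (b \<omega>), \<tau> \<omega>)) \<in> measurable (Sg S) (borel \<Otimes>\<^sub>M borel \<Otimes>\<^sub>M borel)"
        by measurable
    qed (use S in auto)
    show "Measurable.pred (borel \<Otimes>\<^sub>M borel) (\<lambda>p. snd p < (fst p :: real))"
      by measurable
  qed (use \<Phi> p in auto)
  finally show ?thesis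
    by (simp add: prob_uniform_less[OF T(2)] p_def mult.commute)
qed

text \<open>The spectator \<Phi> is generalised in the induction: while contender \<open>j\<close>
  is replaced it carries the untouched factors of the others, and later the already replaced factor
  of \<open>j\<close>. The latter involves only \<open>\<tau>\<close> and \<open>b j\<close>, so it
  is again measurable with respect to \<open>S\<close>.\<close>

lemma replace_contenders:
  assumes T: "\<And>j. T j \<in> borel_measurable (Sg {sT j})" "\<And>j. distributed M lborel (T j) (indicator {0..1})"
    and G: "\<And>j. G j \<in> borel_measurable (Sg {sG j})" "\<And>j. distributed M lborel (G j) (exponential_density \<mu>)"
    and ne: "\<And>j k. sT j \<noteq> sG k" "inj sT" "inj sG"
    and J: "finite J" "\<And>j. j \<in> J \<Longrightarrow> sT j \<notin> S" "\<And>j. j \<in> J \<Longrightarrow> sG j \<notin> S"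
    and \<Phi>: "\<Phi> \<in> borel_measurable (Sg S)" "\<And>\<omega>. 0 \<le> \<Phi> \<omega>"
    and \<tau>: "\<tau> \<in> borel_measurable (Sg S)" and b: "\<And>j. b j \<in> borel_measurable (Sg S)"
    and \<theta>: "0 < \<theta>"
  shows "(\<integral>\<^sup>+\<omega>. ennreal (\<Phi> \<omega> *
      (\<Prod>j\<in>J. lbt_factor (\<tau> \<omega>) (T j \<omega>) (G j \<omega> / path_loss lam_c \<alpha> (norm (b j \<omega> :: plane))) \<theta>)) \<partial>M) =
    (\<integral>\<^sup>+\<omega>. ennreal (\<Phi> \<omega> *
      (\<Prod>j\<in>J. 1 - clamp01 (\<tau> \<omega>) * sensing_prob (\<mu> * \<theta> * (4 * pi / lam_c)\<^sup>2) \<alpha> (b j \<omega>))) \<partial>M)"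
  using J \<Phi>
proof (induction J arbitrary: \<Phi> rule: finite_induct)
  case empty
  then show ?case by simp
next
  case (insert j J)
  define f where "f k \<omega> = lbt_factor (\<tau> \<omega>) (T k \<omega>) (G k \<omega> / path_loss lam_c \<alpha> (norm (b k \<omega>))) \<theta>" for k \<omega>
  define h where "h k \<omega> = 1 - clamp01 (\<tau> \<omega>) * sensing_prob (\<mu> * \<theta> * (4 * pi / lam_c)\<^sup>2) \<alpha> (b k \<omega>)" for k \<omega>
  have f0: "0 \<le> f k \<omega>" for k \<omega>
    by (simp add: f_def lbt_factor_def)
  have h0: "0 \<le> h k \<omega>" for k \<omega>
    using pos \<theta> by (auto simp: h_def intro!: mult_le_one clamp01_bounds sensing_prob_bounds)
  have [measurable]: "path_loss lam_c \<alpha> \<in> borel_measurable borel"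
    unfolding path_loss_def by measurable
  \<comment> \<open>The sources seen by the spectator while \<open>j\<close> is replaced: those of
    \<open>S\<close> together with the timers and fadings of all contenders still waiting.\<close>
  let ?S = "S \<union> (\<Union>k\<in>J. {sT k, sG k})"
  have f_meas: "f k \<in> borel_measurable (Sg ?S)" if k: "k \<in> J" for k
  proof -
    note [measurable] = measurable_Sg_mono[OF \<tau> Un_upper1] measurable_Sg_mono[OF b[of k] Un_upper1]
    have [measurable]: "T k \<in> borel_measurable (Sg ?S)" "G k \<in> borel_measurable (Sg ?S)"
      using k by (auto intro: measurable_Sg_mono[OF T(1)] measurable_Sg_mono[OF G(1)])
    show ?thesis
      unfolding f_def lbt_factor_def by measurable
  qed
  have "(\<integral>\<^sup>+\<omega>. ennreal (\<Phi> \<omega> * (\<Prod>k\<in>insert j J. f k \<omega>)) \<partial>M) =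
      (\<integral>\<^sup>+\<omega>. ennreal ((\<Phi> \<omega> * (\<Prod>k\<in>J. f k \<omega>)) * f j \<omega>) \<partial>M)"
    using insert.hyps by (simp add: mult_ac)
  also have "\<dots> = (\<integral>\<^sup>+\<omega>. ennreal ((\<Phi> \<omega> * (\<Prod>k\<in>J. f k \<omega>)) * h j \<omega>) \<partial>M)"
    unfolding f_def[of j] h_def[of j]
  proof (rule replace_contender[where sT = "sT j" and sG = "sG j" and S = ?S])
    have [measurable]: "\<Phi> \<in> borel_measurable (Sg ?S)"
      by (rule measurable_Sg_mono[OF insert.prems(3)]) auto
    note f_meas[measurable]
    show "(\<lambda>\<omega>. \<Phi> \<omega> * (\<Prod>k\<in>J. f k \<omega>)) \<in> borel_measurable (Sg ?S)"
      by (intro borel_measurable_times borel_measurable_prod f_meas) measurable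
    show "?S \<subseteq> - {sT j, sG j}"
      using insert.hyps insert.prems(1,2) ne by (auto simp: inj_eq) (metis ne(1))+
    show "\<tau> \<in> borel_measurable (Sg ?S)" "b j \<in> borel_measurable (Sg ?S)"
      by (auto intro: measurable_Sg_mono[OF \<tau>] measurable_Sg_mono[OF b])
  qed (use T G ne \<theta> f0 insert.prems in \<open>auto intro!: mult_nonneg_nonneg prod_nonneg\<close>)
  also have "\<dots> = (\<integral>\<^sup>+\<omega>. ennreal ((\<Phi> \<omega> * h j \<omega>) * (\<Prod>k\<in>J. f k \<omega>)) \<partial>M)"
    by (simp add: mult_ac)
  also have "\<dots> = (\<integral>\<^sup>+\<omega>. ennreal ((\<Phi> \<omega> * h j \<omega>) * (\<Prod>k\<in>J. h k \<omega>)) \<partial>M)"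
    unfolding f_def h_def[of _ \<omega> for \<omega>]
  proof (rule insert.IH)
    note [measurable] = insert.prems(3) \<tau> b
    show "(\<lambda>\<omega>. \<Phi> \<omega> * (1 - clamp01 (\<tau> \<omega>) * sensing_prob (\<mu> * \<theta> * (4 * pi / lam_c)\<^sup>2) \<alpha> (b j \<omega>)))
        \<in> borel_measurable (Sg S)"
      by measurable
  qed (use insert.prems h0[unfolded h_def] in auto)
  also have "\<dots> = (\<integral>\<^sup>+\<omega>. ennreal (\<Phi> \<omega> * (\<Prod>k\<in>insert j J. h k \<omega>)) \<partial>M)"
    using insert.hyps by (simp add: mult_ac)
  finally show ?case
    by (simp only: f_def h_def)
qed

end

section \<open>Palm probability of access for a typical AP\<close>

lemma nn_integral_exp_unit_interval:
  assumes "0 < N"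
  shows "(\<integral>\<^sup>+t. ennreal (exp (- (t * N))) * indicator {0..1} t \<partial>lborel) = ennreal ((1 - exp (- N)) / N)"
proof -
  have "(\<integral>\<^sup>+t. ennreal (exp (- (t * N))) * indicator {0..1} t \<partial>lborel) =
      ennreal (- exp (- (1 * N)) / N - - exp (- (0 * N)) / N)"
    using assms
    by (intro nn_integral_FTC_Icc[where F = "\<lambda>t. - exp (- (t * N)) / N"])
       (auto intro!: derivative_eq_intros simp: field_simps)
  then show ?thesis
    using assms by (simp add: diff_divide_distrib)
qed

context lbt_network
begin

context
  fixes \<theta>W \<theta>L :: real
  assumes \<theta>: "0 < \<theta>W" "0 < \<theta>L"
begin

text \<open>The two thresholds are free parameters, since an AP applies different ones to the two
  networks and an eNB applies \<open>\<Gamma>_L\<close> divided by either power.\<close>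

definition p_W where "p_W = sensing_prob (\<mu> * \<theta>W * (4 * pi / lam_c)\<^sup>2) \<alpha>"
definition p_L where "p_L = sensing_prob (\<mu> * \<theta>L * (4 * pi / lam_c)\<^sup>2) \<alpha>"

lemma p_measurable[measurable]: "p_W \<in> borel_measurable borel" "p_L \<in> borel_measurable borel"
  unfolding p_W_def p_L_def by measurable

lemma p_bounds: "0 \<le> p_W z" "p_W z \<le> 1" "0 \<le> p_L z" "p_L z \<le> 1"
  using pos \<theta> by (auto simp: p_W_def p_L_def intro!: sensing_prob_bounds)

lemma thinned_bounds:
  "0 \<le> clamp01 t * p_W z" "clamp01 t * p_W z \<le> 1"
  "0 \<le> clamp01 t * p_L z" "clamp01 t * p_L z \<le> 1"
  using p_bounds clamp01_bounds[of t] by (auto intro!: mult_le_one)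

definition access_W :: "nat \<Rightarrow> 'w \<Rightarrow> real" where
  "access_W i \<omega> =
     infprod_except {i} (\<lambda>j. lbt_factor (tW i \<omega>) (tW j \<omega>)
        (GW j i \<omega> / path_loss lam_c \<alpha> (norm (x j \<omega> - x i \<omega>))) \<theta>W) *
     infprod_except {} (\<lambda>m. lbt_factor (tW i \<omega>) (tL m \<omega>)
        (GLW m i \<omega> / path_loss lam_c \<alpha> (norm (y m \<omega> - x i \<omega>))) \<theta>L)"

lemma measurable_path_loss[measurable]: "path_loss lam_c \<alpha> \<in> borel_measurable borel"
  unfolding path_loss_def by measurable

lemma access_W_measurable[measurable]: "access_W i \<in> borel_measurable M"
  unfolding access_W_def lbt_factor_def by measurable

text \<open>Contenders can be replaced only finitely many at a time, so the identity is shown for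
  products truncated at \<open>n\<close> and carried to the limit by dominated convergence, with 1
  as majorant on both sides.\<close>

lemma nn_integral_access_W:
  assumes [measurable]: "B \<in> sets borel"
  shows "(\<integral>\<^sup>+\<omega>. of_bool (x i \<omega> \<in> B \<and> access_W i \<omega> = 1) \<partial>M) =
    (\<integral>\<^sup>+\<omega>. ennreal (of_bool (x i \<omega> \<in> B) *
       (infprod_except {i} (\<lambda>j. 1 - clamp01 (tW i \<omega>) * p_W (x j \<omega> - x i \<omega>)) *
        infprod_except {} (\<lambda>m. 1 - clamp01 (tW i \<omega>) * p_L (y m \<omega> - x i \<omega>)))) \<partial>M)"
proof -
  define fW where "fW j \<omega> = lbt_factor (tW i \<omega>) (tW j \<omega>)
        (GW j i \<omega> / path_loss lam_c \<alpha> (norm (x j \<omega> - x i \<omega>))) \<theta>W" for j \<omega>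
  define fL where "fL m \<omega> = lbt_factor (tW i \<omega>) (tL m \<omega>)
        (GLW m i \<omega> / path_loss lam_c \<alpha> (norm (y m \<omega> - x i \<omega>))) \<theta>L" for m \<omega>
  define hW where "hW j \<omega> = 1 - clamp01 (tW i \<omega>) * p_W (x j \<omega> - x i \<omega>)" for j \<omega>
  define hL where "hL m \<omega> = 1 - clamp01 (tW i \<omega>) * p_L (y m \<omega> - x i \<omega>)" for m \<omega>
  have [measurable]: "fW j \<in> borel_measurable M" "fL j \<in> borel_measurable M"
    "hW j \<in> borel_measurable M" "hL j \<in> borel_measurable M" for j
    unfolding fW_def fL_def hW_def hL_def lbt_factor_def by measurable
  have f01: "fW j \<omega> \<in> {0, 1}" "fL j \<omega> \<in> {0, 1}" for j \<omega>
    by (auto simp: fW_def fL_def lbt_factor_def)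
  have f_bounds: "0 \<le> fW j \<omega>" "fW j \<omega> \<le> 1" "0 \<le> fL j \<omega>" "fL j \<omega> \<le> 1" for j \<omega>
    using f01[of j \<omega>] by auto
  have h_bounds: "0 \<le> hW j \<omega>" "hW j \<omega> \<le> 1" "0 \<le> hL j \<omega>" "hL j \<omega> \<le> 1" for j \<omega>
    using thinned_bounds by (auto simp: hW_def hL_def)
  define partial where "partial f g n \<omega> =
      ennreal (of_bool (x i \<omega> \<in> B) * ((\<Prod>j\<in>{..<n} - {i}. f j \<omega>) * (\<Prod>m\<in>{..<n} - {}. g m \<omega>)))"
    for f g :: "nat \<Rightarrow> 'w \<Rightarrow> real" and n \<omega>
  define full where "full f g \<omega> = ennreal (of_bool (x i \<omega> \<in> B) *
      (infprod_except {i} (\<lambda>j. f j \<omega>) * infprod_except {} (\<lambda>m. g m \<omega>)))"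
    for f g :: "nat \<Rightarrow> 'w \<Rightarrow> real" and \<omega>
  have lim: "(\<lambda>n. \<integral>\<^sup>+\<omega>. partial f g n \<omega> \<partial>M) \<longlonglongrightarrow> (\<integral>\<^sup>+\<omega>. full f g \<omega> \<partial>M)"
    if fg: "\<And>j \<omega>. 0 \<le> f j \<omega>" "\<And>j \<omega>. f j \<omega> \<le> 1" "\<And>j \<omega>. 0 \<le> g j \<omega>" "\<And>j \<omega>. g j \<omega> \<le> 1"
      and [measurable]: "\<And>j. f j \<in> borel_measurable M" "\<And>j. g j \<in> borel_measurable M" for f g
  proof (rule nn_integral_dominated_convergence[where w = "\<lambda>_. 1"])
    show "AE \<omega> in M. (\<lambda>n. partial f g n \<omega>) \<longlonglongrightarrow> full f g \<omega>"
      unfolding partial_def full_def using fg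
      by (intro AE_I2 tendsto_ennrealI tendsto_mult tendsto_const infprod_except_tendsto)
    show "AE \<omega> in M. partial f g n \<omega> \<le> 1" for n
      unfolding partial_def ennreal_le_1 using fg
      by (intro AE_I2 mult_le_one prod_le_1 prod_nonneg mult_nonneg_nonneg) auto
  qed (auto simp: emeasure_space_1 partial_def full_def)
  have "(\<integral>\<^sup>+\<omega>. partial fW fL n \<omega> \<partial>M) = (\<integral>\<^sup>+\<omega>. partial hW hL n \<omega> \<partial>M)" for n
  proof -
    let ?S = "{AP_points, ENB_points, AP_timer i}"
    let ?S' = "?S \<union> range ENB_timer \<union> range (\<lambda>m. Fading_LW m i)"
    have m: "tW i \<in> borel_measurable (Sg ?S)" "x j \<in> borel_measurable (Sg ?S)" "y j \<in> borel_measurable (Sg ?S)"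
      "tW i \<in> borel_measurable (Sg ?S')" "x j \<in> borel_measurable (Sg ?S')" "y j \<in> borel_measurable (Sg ?S')"
      "tL j \<in> borel_measurable (Sg ?S')" "GLW j i \<in> borel_measurable (Sg ?S')" for j
      by (auto intro!: Sg_measurable)
    have single: "tW j \<in> borel_measurable (Sg {AP_timer j})" "tL j \<in> borel_measurable (Sg {ENB_timer j})"
      "GW j i \<in> borel_measurable (Sg {Fading_W j i})" "GLW j i \<in> borel_measurable (Sg {Fading_LW j i})" for j
      by (auto intro!: Sg_measurable)
    note [measurable] = m
    have "(\<integral>\<^sup>+\<omega>. partial fW fL n \<omega> \<partial>M) =
        (\<integral>\<^sup>+\<omega>. ennreal ((of_bool (x i \<omega> \<in> B) * (\<Prod>m\<in>{..<n} - {}. fL m \<omega>)) * (\<Prod>j\<in>{..<n} - {i}. fW j \<omega>)) \<partial>M)"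
      by (simp add: partial_def mult_ac)
    also have "\<dots> = (\<integral>\<^sup>+\<omega>. ennreal ((of_bool (x i \<omega> \<in> B) * (\<Prod>m\<in>{..<n} - {}. fL m \<omega>)) * (\<Prod>j\<in>{..<n} - {i}. hW j \<omega>)) \<partial>M)"
      unfolding fW_def hW_def p_W_def
    proof (rule replace_contenders[where sT = AP_timer and sG = "\<lambda>j. Fading_W j i" and S = ?S'])
      have "fL m \<in> borel_measurable (Sg ?S')" for m
        unfolding fL_def lbt_factor_def by measurable
      note [measurable] = this
      show "(\<lambda>\<omega>. of_bool (x i \<omega> \<in> B) * (\<Prod>m\<in>{..<n} - {}. fL m \<omega>)) \<in> borel_measurable (Sg ?S')"
        by measurable
      show "(\<lambda>\<omega>. x j \<omega> - x i \<omega>) \<in> borel_measurable (Sg ?S')" for j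
        by measurable
    qed (use single m f_bounds timer_W fading_W \<theta> in \<open>auto simp: inj_def intro!: prod_nonneg\<close>)
    also have "\<dots> = (\<integral>\<^sup>+\<omega>. ennreal ((of_bool (x i \<omega> \<in> B) * (\<Prod>j\<in>{..<n} - {i}. hW j \<omega>)) * (\<Prod>m\<in>{..<n} - {}. fL m \<omega>)) \<partial>M)"
      by (simp add: mult_ac)
    also have "\<dots> = (\<integral>\<^sup>+\<omega>. ennreal ((of_bool (x i \<omega> \<in> B) * (\<Prod>j\<in>{..<n} - {i}. hW j \<omega>)) * (\<Prod>m\<in>{..<n} - {}. hL m \<omega>)) \<partial>M)"
      unfolding fL_def hL_def p_L_def
    proof (rule replace_contenders[where sT = ENB_timer and sG = "\<lambda>m. Fading_LW m i" and S = ?S])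
      have "hW j \<in> borel_measurable (Sg ?S)" for j
        unfolding hW_def by measurable
      note [measurable] = this
      show "(\<lambda>\<omega>. of_bool (x i \<omega> \<in> B) * (\<Prod>j\<in>{..<n} - {i}. hW j \<omega>)) \<in> borel_measurable (Sg ?S)"
        by measurable
      show "(\<lambda>\<omega>. y m \<omega> - x i \<omega>) \<in> borel_measurable (Sg ?S)" for m
        by measurable
    qed (use single m h_bounds timer_L fading_LW \<theta> in \<open>auto simp: inj_def intro!: prod_nonneg\<close>)
    finally show ?thesis
      by (simp add: partial_def mult_ac)
  qed
  then have "(\<integral>\<^sup>+\<omega>. full fW fL \<omega> \<partial>M) = (\<integral>\<^sup>+\<omega>. full hW hL \<omega> \<partial>M)"
    using LIMSEQ_unique[OF lim[of fW fL]] lim[of hW hL] f_bounds h_bounds by simp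
  \<comment> \<open>The unreplaced factors take only the values 0 and 1, so the product of the
    limits is itself the indicator of access.\<close>
  moreover have "full fW fL \<omega> = of_bool (x i \<omega> \<in> B \<and> access_W i \<omega> = 1)" for \<omega>
    using infprod_except_zero_one[of "\<lambda>j. fW j \<omega>" "{i}"] infprod_except_zero_one[of "\<lambda>j. fL j \<omega>" "{}"] f01
    unfolding full_def access_W_def fW_def[symmetric] fL_def[symmetric] by auto
  ultimately show ?thesis
    by (simp add: full_def hW_def hL_def)
qed

lemma integral_p_pos: "0 < (\<integral>z. p_W z \<partial>lborel)" "0 < (\<integral>z. p_L z \<partial>lborel)"
  using pos \<theta> by (simp_all add: p_W_def p_L_def integral_sensing_prob integral_exp_neg_norm_powr_pos[simplified])

lemma integrable_p: "integrable lborel p_W" "integrable lborel p_L"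
  using pos \<theta> by (auto simp: p_W_def p_L_def intro!: integrable_sensing_prob)

text \<open>The share of index \<open>i\<close> with its timer frozen at \<open>t\<close> and the
  eNBs averaged out. Lebesgue measure is translation invariant, so the Laplace functional of the
  eNBs does not depend on the position \<open>x i\<close> and splits off as a constant
  factor.\<close>

definition mecke_term :: "plane set \<Rightarrow> nat \<Rightarrow> real \<Rightarrow> ennreal" where
  "mecke_term B i t = (\<integral>\<^sup>+\<omega>. ennreal (of_bool (x i \<omega> \<in> B) *
     infprod_except {i} (\<lambda>j. 1 - clamp01 t * p_W (x j \<omega> - x i \<omega>))) \<partial>M) *
   ennreal (exp (- lam_L * (clamp01 t * (\<integral>z. p_L z \<partial>lborel))))"

lemma nn_integral_access_W_mecke_term:
  assumes [measurable]: "B \<in> sets borel"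
  shows "(\<integral>\<^sup>+\<omega>. of_bool (x i \<omega> \<in> B \<and> access_W i \<omega> = 1) \<partial>M) = (\<integral>\<^sup>+\<omega>. mecke_term B i (tW i \<omega>) \<partial>M)"
proof -
  define IL where "IL = (\<integral>z. p_L z \<partial>lborel)"
  define \<phi> where "\<phi> \<omega> = of_bool (x i \<omega> \<in> B) *
    infprod_except {i} (\<lambda>j. 1 - clamp01 (tW i \<omega>) * p_W (x j \<omega> - x i \<omega>))" for \<omega>
  have \<phi>: "0 \<le> \<phi> \<omega>" for \<omega>
    unfolding \<phi>_def using thinned_bounds by (auto intro!: infprod_except_bounds)
  let ?P = "Pi\<^sub>M UNIV (\<lambda>_. borel) :: (nat \<Rightarrow> plane) measure"
  let ?f = "\<lambda>p. ennreal (fst (fst p) * infprod_except {} (\<lambda>m. 1 - clamp01 (snd (snd (fst p))) * p_L (snd p m - fst (snd (fst p)))))"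
  have "(\<integral>\<^sup>+\<omega>. of_bool (x i \<omega> \<in> B \<and> access_W i \<omega> = 1) \<partial>M) =
      (\<integral>\<^sup>+\<omega>. ?f ((\<phi> \<omega>, x i \<omega>, tW i \<omega>), \<lambda>m. y m \<omega>) \<partial>M)"
    unfolding nn_integral_access_W[OF assms] \<phi>_def by (simp add: mult_ac)
  also have "\<dots> = (\<integral>\<^sup>+\<omega>. \<integral>\<^sup>+\<omega>'. ?f ((\<phi> \<omega>, x i \<omega>, tW i \<omega>), \<lambda>m. y m \<omega>') \<partial>M \<partial>M)"
  proof (rule nn_integral_indep_pair)
    show "indep_pair (borel \<Otimes>\<^sub>M borel \<Otimes>\<^sub>M borel) (\<lambda>\<omega>. (\<phi> \<omega>, x i \<omega>, tW i \<omega>)) ?P (\<lambda>\<omega> m. y m \<omega>)"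
    proof (rule indep_pair_Sg)
      let ?S = "{AP_points, AP_timer i}"
      have [measurable]: "x j \<in> borel_measurable (Sg ?S)" "tW i \<in> borel_measurable (Sg ?S)" for j
        by (auto intro!: Sg_measurable)
      show "(\<lambda>\<omega>. (\<phi> \<omega>, x i \<omega>, tW i \<omega>)) \<in> measurable (Sg ?S) (borel \<Otimes>\<^sub>M borel \<Otimes>\<^sub>M borel)"
        unfolding \<phi>_def by measurable
      show "(\<lambda>\<omega> m. y m \<omega>) \<in> measurable (Sg {ENB_points}) ?P"
        by (rule Sg_points_measurable) simp
    qed simp
    show "?f \<in> borel_measurable ((borel \<Otimes>\<^sub>M borel \<Otimes>\<^sub>M borel) \<Otimes>\<^sub>M ?P)"
      by measurable
  qed
  also have "\<dots> = (\<integral>\<^sup>+\<omega>. ennreal (\<phi> \<omega>) * ennreal (exp (- lam_L * (clamp01 (tW i \<omega>) * IL))) \<partial>M)"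
  proof (rule nn_integral_cong)
    fix \<omega>
    let ?t = "clamp01 (tW i \<omega>)" and ?u = "x i \<omega>"
    have "(\<integral>\<^sup>+\<omega>'. ennreal (\<phi> \<omega> * infprod_except {} (\<lambda>m. 1 - ?t * p_L (y m \<omega>' - ?u))) \<partial>M) =
        ennreal (\<phi> \<omega>) * (\<integral>\<^sup>+\<omega>'. ennreal (infprod_except {} (\<lambda>m. 1 - ?t * p_L (y m \<omega>' - ?u))) \<partial>M)"
      using \<phi> by (simp add: ennreal_mult' nn_integral_cmult)
    also have "(\<integral>\<^sup>+\<omega>'. ennreal (infprod_except {} (\<lambda>m. 1 - ?t * p_L (y m \<omega>' - ?u))) \<partial>M) =
        ennreal (exp (- lam_L * (\<integral>z. ?t * p_L (z - ?u) \<partial>lborel)))"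
      by (rule L.laplace) (auto intro!: thinned_bounds integrable_mult_right integrable_lborel_shift integrable_p)
    also have "(\<integral>z. ?t * p_L (z - ?u) \<partial>lborel) = ?t * IL"
      by (simp add: integral_lborel_shift[of p_L] IL_def)
    finally show "(\<integral>\<^sup>+\<omega>'. ?f ((\<phi> \<omega>, x i \<omega>, tW i \<omega>), \<lambda>m. y m \<omega>') \<partial>M) =
        ennreal (\<phi> \<omega>) * ennreal (exp (- lam_L * (?t * IL)))"
      by simp
  qed
  also have "\<dots> = (\<integral>\<^sup>+\<omega>. (\<lambda>p. ennreal (of_bool (snd p i \<in> B) *
      infprod_except {i} (\<lambda>j. 1 - clamp01 (fst p) * p_W (snd p j - snd p i))) *
      ennreal (exp (- lam_L * (clamp01 (fst p) * IL)))) (tW i \<omega>, \<lambda>j. x j \<omega>) \<partial>M)"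
    by (simp add: \<phi>_def)
  \<comment> \<open>Separating the timer from the AP points leaves an inner expectation over the
    points alone, in which the timer is a fixed number.\<close>
  also have "\<dots> = (\<integral>\<^sup>+\<omega>. \<integral>\<^sup>+\<omega>'. (\<lambda>p. ennreal (of_bool (snd p i \<in> B) *
      infprod_except {i} (\<lambda>j. 1 - clamp01 (fst p) * p_W (snd p j - snd p i))) *
      ennreal (exp (- lam_L * (clamp01 (fst p) * IL)))) (tW i \<omega>, \<lambda>j. x j \<omega>') \<partial>M \<partial>M)"
  proof (rule nn_integral_indep_pair)
    show "indep_pair borel (tW i) ?P (\<lambda>\<omega> j. x j \<omega>)"
    proof (rule indep_pair_Sg)
      show "tW i \<in> borel_measurable (Sg {AP_timer i})"
        by (rule Sg_measurable) simp
      show "(\<lambda>\<omega> j. x j \<omega>) \<in> measurable (Sg {AP_points}) ?P"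
        by (rule Sg_points_measurable) simp
    qed simp
  qed measurable
  also have "\<dots> = (\<integral>\<^sup>+\<omega>. mecke_term B i (tW i \<omega>) \<partial>M)"
    by (simp add: mecke_term_def IL_def nn_integral_multc)
  finally show ?thesis .
qed

text \<open>The individual terms depend on how the points are numbered; only their sum is determined
  by the Poisson property, through the Mecke formula for the kernel \<open>t * p_W\<close>.\<close>

lemma sum_mecke_term:
  assumes B: "B \<in> sets borel" and t: "t \<in> {0..1}"
  shows "(\<Sum>i. mecke_term B i t) = ennreal lam_W * emeasure lborel B *
    ennreal (exp (- (t * (lam_W * (\<integral>z. p_W z \<partial>lborel) + lam_L * (\<integral>z. p_L z \<partial>lborel)))))"
proof -
  define IW where "IW = (\<integral>z. p_W z \<partial>lborel)"
  define IL where "IL = (\<integral>z. p_L z \<partial>lborel)"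
  have c: "clamp01 t = t"
    using t by (simp add: clamp01_def)
  have "(\<Sum>i. mecke_term B i t) = (\<Sum>i. \<integral>\<^sup>+\<omega>. ennreal (of_bool (x i \<omega> \<in> B) *
     infprod_except {i} (\<lambda>j. 1 - t * p_W (x j \<omega> - x i \<omega>))) \<partial>M) * ennreal (exp (- lam_L * (t * IL)))"
    unfolding mecke_term_def c IL_def by (rule ennreal_suminf_multc)
  also have "(\<Sum>i. \<integral>\<^sup>+\<omega>. ennreal (of_bool (x i \<omega> \<in> B) *
     infprod_except {i} (\<lambda>j. 1 - t * p_W (x j \<omega> - x i \<omega>))) \<partial>M) =
     ennreal (lam_W * exp (- lam_W * (\<integral>z. t * p_W z \<partial>lborel))) * emeasure lborel B"
  proof (rule W.mecke_formula[where g = "\<lambda>z. t * p_W z"])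
    show "continuous_on (- {0}) (\<lambda>z. t * p_W z)"
      unfolding p_W_def by (intro continuous_intros continuous_on_sensing_prob)
    show "t * p_W 0 = 0"
      by (simp add: p_W_def sensing_prob_def)
  qed (use B thinned_bounds[of t] integrable_p in \<open>auto simp: c\<close>)
  also have "ennreal (lam_W * exp (- lam_W * (\<integral>z. t * p_W z \<partial>lborel))) * emeasure lborel B *
      ennreal (exp (- lam_L * (t * IL))) =
    ennreal lam_W * emeasure lborel B * (ennreal (exp (- lam_W * (t * IW))) * ennreal (exp (- lam_L * (t * IL))))"
    using pos by (simp add: IW_def ennreal_mult mult_ac)
  also have "ennreal (exp (- lam_W * (t * IW))) * ennreal (exp (- lam_L * (t * IL))) =
      ennreal (exp (- (t * (lam_W * IW + lam_L * IL))))"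
    by (simp add: ennreal_mult[symmetric] exp_add[symmetric] algebra_simps)
  finally show ?thesis
    by (simp add: IW_def IL_def)
qed

lemma palm_prob_access_W:
  assumes B[measurable]: "B \<in> sets borel" and B_pos: "0 < emeasure lborel B" "emeasure lborel B < \<infinity>"
    and N: "N = lam_W * (\<integral>z. p_W z \<partial>lborel) + lam_L * (\<integral>z. p_L z \<partial>lborel)"
  shows "palm_prob M lam_W x (\<lambda>i \<omega>. access_W i \<omega> = 1) B = ennreal ((1 - exp (- N)) / N)"
proof -
  have "0 < N"
    using pos integral_p_pos by (simp add: N add_pos_pos)
  have [measurable]: "mecke_term B i \<in> borel_measurable borel" for i
    unfolding mecke_term_def by measurable
  have "(\<integral>\<^sup>+\<omega>. (\<Sum>i. of_bool (x i \<omega> \<in> B \<and> access_W i \<omega> = 1)) \<partial>M) =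
      (\<Sum>i. \<integral>\<^sup>+\<omega>. of_bool (x i \<omega> \<in> B \<and> access_W i \<omega> = 1) \<partial>M)"
    by (rule nn_integral_suminf) measurable
  \<comment> \<open>Each term involves a different timer, but all timers have the same density.
    Hence one variable \<open>t\<close> serves for every index, and the sum can move under the
    integral.\<close>
  also have "\<dots> = (\<Sum>i. \<integral>\<^sup>+t. indicator {0..1} t * mecke_term B i t \<partial>lborel)"
    unfolding nn_integral_access_W_mecke_term[OF B]
    by (intro suminf_cong distributed_nn_integral[OF timer_W, symmetric]) measurable
  also have "\<dots> = (\<integral>\<^sup>+t. (\<Sum>i. indicator {0..1} t * mecke_term B i t) \<partial>lborel)"
    by (rule nn_integral_suminf[symmetric]) measurable
  also have "\<dots> = (\<integral>\<^sup>+t. ennreal lam_W * emeasure lborel B * (ennreal (exp (- (t * N))) * indicator {0..1} t) \<partial>lborel)"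
    using sum_mecke_term[OF B]
    by (intro nn_integral_cong) (auto simp: indicator_def N)
  also have "\<dots> = ennreal lam_W * emeasure lborel B * ennreal ((1 - exp (- N)) / N)"
    by (simp add: nn_integral_cmult nn_integral_exp_unit_interval[OF \<open>0 < N\<close>])
  finally have "palm_prob M lam_W x (\<lambda>i \<omega>. access_W i \<omega> = 1) B =
      (ennreal ((1 - exp (- N)) / N) * (ennreal lam_W * emeasure lborel B)) / (ennreal lam_W * emeasure lborel B)"
    by (simp add: palm_prob_def mult.commute)
  \<comment> \<open>Cancellation in the extended reals requires \<open>lam_W\<close> times the
    measure of \<open>B\<close> to be neither 0 nor infinite.\<close>
  also have "\<dots> = ennreal ((1 - exp (- N)) / N)"
    using pos B_pos by (intro mult_divide_eq_ennreal) (auto simp: ennreal_mult_eq_top_iff)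
  finally show ?thesis .
qed

end

lemma palm_prob_ap_access:
  assumes P: "0 < P_W" "0 < P_L" "0 < \<Gamma>_cs" "0 < \<Gamma>_ed"
    and B: "B \<in> sets borel" "0 < emeasure lborel B" "emeasure lborel B < \<infinity>"
  defines "N \<equiv> N3 (path_loss lam_c \<alpha>) \<mu> lam_W P_W \<Gamma>_cs + N3 (path_loss lam_c \<alpha>) \<mu> lam_L P_L \<Gamma>_ed"
  shows "palm_prob M lam_W x
      (\<lambda>i \<omega>. ap_access (path_loss lam_c \<alpha>) P_W P_L \<Gamma>_cs \<Gamma>_ed x y tW tL GW GLW i \<omega> = 1) B =
    ennreal ((1 - exp (- N)) / N)"
proof -
  have \<theta>: "0 < \<Gamma>_cs / P_W" "0 < \<Gamma>_ed / P_L"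
    using P by simp_all
  have "N3 (path_loss lam_c \<alpha>) \<mu> lam P \<Gamma> =
      lam * (\<integral>z. sensing_prob (\<mu> * (\<Gamma> / P) * (4 * pi / lam_c)\<^sup>2) \<alpha> z \<partial>lborel)" for lam P \<Gamma>
    by (simp add: N3_def integral_sensing_prob path_loss_def mult_ac)
  then have "N = lam_W * (\<integral>z. p_W (\<Gamma>_cs / P_W) z \<partial>lborel) + lam_L * (\<integral>z. p_L (\<Gamma>_ed / P_L) z \<partial>lborel)"
    by (simp add: N_def p_W_def[OF \<theta>] p_L_def[OF \<theta>])
  from palm_prob_access_W[OF \<theta> B this] show ?thesis
    by (simp add: access_W_def[OF \<theta>] ap_access_def)
qed

end

section \<open>Exchange of the two networks\<close>

primrec swap_source :: "source \<Rightarrow> source" where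
  "swap_source AP_points = ENB_points"
| "swap_source ENB_points = AP_points"
| "swap_source (AP_timer i) = ENB_timer i"
| "swap_source (ENB_timer i) = AP_timer i"
| "swap_source (Fading_W j i) = Fading_L j i"
| "swap_source (Fading_LW j i) = Fading_WL j i"
| "swap_source (Fading_WL j i) = Fading_LW j i"
| "swap_source (Fading_L j i) = Fading_W j i"

lemma swap_source_swap_source[simp]: "swap_source (swap_source s) = s"
  by (cases s) auto

lemma source_sigma_swap:
  "source_sigma M y x tL tW GL GWL GLW GW s = source_sigma M x y tW tL GW GLW GWL GL (swap_source s)"
  by (cases s) auto

text \<open>The exchanged family is the original one reindexed along an involution, and independence
  of a family is invariant under injective reindexing.\<close>

lemma (in prob_space) indep_sets_source_sigma_swap:
  assumes "indep_sets (source_sigma M x y tW tL GW GLW GWL GL) UNIV"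
  shows "indep_sets (source_sigma M y x tL tW GL GWL GLW GW) UNIV"
proof (rule indep_setsI)
  show "source_sigma M y x tL tW GL GWL GLW GW s \<subseteq> events" for s
    using assms by (simp add: indep_sets_def source_sigma_swap[of M y x tL tW GL GWL GLW GW])
next
  fix A J
  assume J: "J \<noteq> {}" "J \<subseteq> UNIV" "finite J"
    and A: "\<forall>j\<in>J. A j \<in> source_sigma M y x tL tW GL GWL GLW GW j"
  have inj: "inj_on swap_source J"
    by (metis inj_onI swap_source_swap_source)
  have "prob (\<Inter>j\<in>swap_source ` J. A (swap_source j)) = (\<Prod>j\<in>swap_source ` J. prob (A (swap_source j)))"
    using J A by (intro indep_setsD[OF assms]) (auto simp: source_sigma_swap[of M y x tL tW GL GWL GLW GW])
  then show "prob (\<Inter>j\<in>J. A j) = (\<Prod>j\<in>J. prob (A j))"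
    by (simp add: prod.reindex[OF inj] image_image)
qed

theorem lemma6:
  fixes M :: "'w measure"
    and x y :: "nat \<Rightarrow> 'w \<Rightarrow> plane"
    and tW tL :: "nat \<Rightarrow> 'w \<Rightarrow> real"
    and GW GLW GWL GL :: "nat \<Rightarrow> nat \<Rightarrow> 'w \<Rightarrow> real"
    and lam_W lam_L P_W P_L lam_c \<alpha> \<mu> \<Gamma>_cs \<Gamma>_ed \<Gamma>_L :: real
  defines "l \<equiv> path_loss lam_c \<alpha>"
  defines "N_W \<equiv> N3 l \<mu> lam_W P_W"
    and "N_L \<equiv> N3 l \<mu> lam_L P_L"
  assumes prob: "prob_space M"
    and pos: "lam_W > 0" "lam_L > 0" "P_W > 0" "P_L > 0" "lam_c > 0" "\<alpha> > 0" "\<mu> > 0"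
             "\<Gamma>_cs > 0" "\<Gamma>_ed > 0" "\<Gamma>_L > 0"
    and ppp_W: "homogeneous_ppp M lam_W x"
    and ppp_L: "homogeneous_ppp M lam_L y"
    and timer_W: "\<And>i. distributed M lborel (tW i) (indicator {0..1})"
    and timer_L: "\<And>k. distributed M lborel (tL k) (indicator {0..1})"
    and fading_W: "\<And>j i. distributed M lborel (GW j i) (exponential_density \<mu>)"
    and fading_LW: "\<And>m i. distributed M lborel (GLW m i) (exponential_density \<mu>)"
    and fading_WL: "\<And>j k. distributed M lborel (GWL j k) (exponential_density \<mu>)"
    and fading_L: "\<And>m k. distributed M lborel (GL m k) (exponential_density \<mu>)"
    and indep: "prob_space.indep_sets M (source_sigma M x y tW tL GW GLW GWL GL) UNIV"
  shows "(\<forall>B\<in>sets borel. 0 < emeasure lborel B \<and> emeasure lborel B < \<infinity> \<longrightarrow>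
           palm_prob M lam_W x
             (\<lambda>i \<omega>. ap_access l P_W P_L \<Gamma>_cs \<Gamma>_ed x y tW tL GW GLW i \<omega> = 1) B =
           ennreal ((1 - exp (- N_W \<Gamma>_cs - N_L \<Gamma>_ed)) / (N_W \<Gamma>_cs + N_L \<Gamma>_ed))) \<and>
         (\<forall>B\<in>sets borel. 0 < emeasure lborel B \<and> emeasure lborel B < \<infinity> \<longrightarrow>
           palm_prob M lam_L y
             (\<lambda>k \<omega>. enb_access l P_W P_L \<Gamma>_L x y tW tL GWL GL k \<omega> = 1) B =
           ennreal ((1 - exp (- N_W \<Gamma>_L - N_L \<Gamma>_L)) / (N_W \<Gamma>_L + N_L \<Gamma>_L)))"
proof (intro conjI ballI impI)
  interpret prob_space M by fact
  interpret ap: lbt_network M x y tW tL GW GLW GWL GL lam_W lam_L lam_c \<alpha> \<mu>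
    by unfold_locales (use assms in auto)
  interpret enb: lbt_network M y x tL tW GL GWL GLW GW lam_L lam_W lam_c \<alpha> \<mu>
    by unfold_locales (use assms indep_sets_source_sigma_swap[OF indep] in auto)
  fix B :: "plane set"
  assume B: "B \<in> sets borel" "0 < emeasure lborel B \<and> emeasure lborel B < \<infinity>"
  show "palm_prob M lam_W x
      (\<lambda>i \<omega>. ap_access l P_W P_L \<Gamma>_cs \<Gamma>_ed x y tW tL GW GLW i \<omega> = 1) B =
    ennreal ((1 - exp (- N_W \<Gamma>_cs - N_L \<Gamma>_ed)) / (N_W \<Gamma>_cs + N_L \<Gamma>_ed))"
    using ap.palm_prob_ap_access[of P_W P_L \<Gamma>_cs \<Gamma>_ed B] pos B
    by (simp add: l_def N_W_def N_L_def)
  \<comment> \<open>Seen from an eNB, its own network takes the part of the APs, and both thresholds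
    are \<open>\<Gamma>_L\<close>; the two sides differ only in the order of the two
    products.\<close>
  have "enb_access l P_W P_L \<Gamma>_L x y tW tL GWL GL k \<omega> =
      ap_access l P_L P_W \<Gamma>_L \<Gamma>_L y x tL tW GL GWL k \<omega>" for k \<omega>
    by (simp add: enb_access_def ap_access_def)
  then show "palm_prob M lam_L y
      (\<lambda>k \<omega>. enb_access l P_W P_L \<Gamma>_L x y tW tL GWL GL k \<omega> = 1) B =
    ennreal ((1 - exp (- N_W \<Gamma>_L - N_L \<Gamma>_L)) / (N_W \<Gamma>_L + N_L \<Gamma>_L))"
    using enb.palm_prob_ap_access[of P_L P_W \<Gamma>_L \<Gamma>_L B] pos B
    by (simp add: l_def N_W_def N_L_def add.commute minus_diff_commute)
qed

end
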